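(* Let $P=(p_n)$ and $Q=(q_n)$ be basic sequences and let $r_n=p_n-q_n$. If $(p_n)$, $(q_n)$ and $(r_n)$ grow nicely, $p_n>q_n$ for all natural numbers $n$, and $$\lim_{n\to\infty}\frac{\log r_n}{\log p_n}=\gamma\in(0,1],$$ then for all $\alpha\in[0,1]$ $$\dim_H\left(\mathscr{V}_{P,Q}(\alpha)\right)\ge 1-\frac{\alpha}{\gamma}.$$ Thus $\dim_H(\mathscr{V}_{P,Q}(\alpha))>0$ if $0\le\alpha<\gamma$.
   Context: A basic sequence is a sequence $Q=(q_n)_{n\ge1}$ of integers $q_n\ge 2$. The $P$-Cantor series expansion of $x\in\mathbb{R}$, abbreviated $x=E_0.E_1E_2\cdots$ w.r.t. $P$, is the unique expansion $x=E_0+\sum_{n\ge1}\frac{E_n}{p_1\cdots p_n}$ with $E_0=\lfloor x\rfloor$, $E_n\in\{0,\ldots,p_n-1\}$ for $n\ge 1$, and $E_n\ne p_n-1$ for infinitely many $n$. For such $x$, $\psi_{P,Q}(x)=\sum_{n=1}^\infty\frac{\min(E_n,q_n-1)}{q_1\cdots q_n}$. For $w\in(0,1]$ put $\mathscr{L}_{P,Q}(w)=\{x\in(0,1):\psi_{P,Q}(x)=w\}$, and for $\alpha\in[0,1]$ put $\mathscr{V}_{P,Q}(\alpha)=\{w\in\psi_{P,Q}((0,1)):\dim_H(\mathscr{L}_{P,Q}(w))=\alpha\}$. Here $\dim_H$ is Hausdorff dimension (with $\dim_H\emptyset=0$). Let $\tau_n=n(n+1)/2$. An eventually non-decreasing sequence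 of real numbers $(s_n)$ grows nicely if $\lim_{n\to\infty}s_n=\infty$ and $\lim_{n\to\infty}\frac{\log s_{\tau_{n+2}}}{\log s_{\tau_n}}=1$. *)

theory Defs
  imports "HOL-Analysis.Analysis"
begin

section \<open>Hausdorff dimension\<close>

text \<open>
  The cases make \<open>d\<^sup>s\<close> the usual gauge also for \<open>s = 0\<close> (counting measure): Isabelle's
  \<open>powr\<close> has \<open>0 powr 0 = 0\<close>, while a nonempty set must contribute \<open>1\<close> there.
\<close>
definition hausdorff_gauge :: "real \<Rightarrow> 'a::metric_space set \<Rightarrow> ennreal" where
  "hausdorff_gauge s U =
     (if U = {} then 0 else if s = 0 then 1 else ennreal (diameter U powr s))"

text \<open>
  Boundedness is required explicitly because \<^const>\<open>diameter\<close> is real-valued and thus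
  unspecified on unbounded sets.
\<close>
definition delta_covers :: "real \<Rightarrow> 'a::metric_space set \<Rightarrow> (nat \<Rightarrow> 'a set) set" where
  "delta_covers \<delta> A =
     {U. (\<forall>i. bounded (U i) \<and> diameter (U i) \<le> \<delta>) \<and> A \<subseteq> (\<Union>i. U i)}"

definition hausdorff_measure :: "real \<Rightarrow> 'a::metric_space set \<Rightarrow> ennreal" where
  "hausdorff_measure s A =
     (SUP \<delta>\<in>{0<..}. INF U\<in>delta_covers \<delta> A. \<Sum>i. hausdorff_gauge s (U i))"

definition hausdorff_dim :: "'a::metric_space set \<Rightarrow> ereal" where
  "hausdorff_dim A = Inf {ereal s | s. 0 \<le> s \<and> hausdorff_measure s A = 0}"

lemma hausdorff_dim_nonneg: "0 \<le> hausdorff_dim A"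
  unfolding hausdorff_dim_def by (rule Inf_greatest) auto

lemma hausdorff_dim_empty: "hausdorff_dim ({} :: 'a::metric_space set) = 0"
proof -
  have "(INF U\<in>delta_covers \<delta> {}. \<Sum>i. hausdorff_gauge 0 (U i :: 'a set)) \<le> 0"
    if "0 < \<delta>" for \<delta>
  proof (rule INF_lower2)
    show "(\<lambda>_. {}) \<in> delta_covers \<delta> ({} :: 'a set)"
      using that by (simp add: delta_covers_def)
  qed (simp add: hausdorff_gauge_def)
  then have "hausdorff_measure 0 ({} :: 'a set) \<le> 0"
    unfolding hausdorff_measure_def by (intro SUP_least) auto
  then have "hausdorff_dim ({} :: 'a set) \<le> ereal 0"
    unfolding hausdorff_dim_def by (intro Inf_lower) auto
  then show ?thesis
    using hausdorff_dim_nonneg[of "{} :: 'a set"] by (simp add: zero_ereal_def)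
qed


section \<open>Cantor series expansions\<close>

text \<open>
  Sequences indexed by \<open>n \<ge> 1\<close> are functions on \<^typ>\<open>nat\<close> whose value at \<open>0\<close> is irrelevant.
  The exception is a digit sequence \<open>E\<close>, where \<open>E 0\<close> is the integer part.
\<close>

definition basic_sequence :: "(nat \<Rightarrow> int) \<Rightarrow> bool" where
  "basic_sequence Q \<longleftrightarrow> (\<forall>n\<ge>1. 2 \<le> Q n)"

definition cantor_expansion :: "(nat \<Rightarrow> int) \<Rightarrow> real \<Rightarrow> (nat \<Rightarrow> int) \<Rightarrow> bool" where
  "cantor_expansion P x E \<longleftrightarrow>
     E 0 = \<lfloor>x\<rfloor> \<and>
     (\<forall>n\<ge>1. E n \<in> {0..P n - 1}) \<and>
     (\<exists>\<^sub>\<infinity>n. E n \<noteq> P n - 1) \<and>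
     (\<lambda>n. real_of_int (E (Suc n)) / real_of_int (\<Prod>k=1..Suc n. P k))
       sums (x - real_of_int (E 0))"

definition cantor_digits :: "(nat \<Rightarrow> int) \<Rightarrow> real \<Rightarrow> nat \<Rightarrow> int" where
  "cantor_digits P x = (THE E. cantor_expansion P x E)"

definition psi :: "(nat \<Rightarrow> int) \<Rightarrow> (nat \<Rightarrow> int) \<Rightarrow> real \<Rightarrow> real" where
  "psi P Q x =
     (\<Sum>n. real_of_int (min (cantor_digits P x (Suc n)) (Q (Suc n) - 1))
            / real_of_int (\<Prod>k=1..Suc n. Q k))"

definition level_set :: "(nat \<Rightarrow> int) \<Rightarrow> (nat \<Rightarrow> int) \<Rightarrow> real \<Rightarrow> real set" where
  "level_set P Q w = {x \<in> {0<..<1}. psi P Q x = w}"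

definition dim_spectrum_set :: "(nat \<Rightarrow> int) \<Rightarrow> (nat \<Rightarrow> int) \<Rightarrow> real \<Rightarrow> real set" where
  "dim_spectrum_set P Q \<alpha> =
     {w \<in> psi P Q ` {0<..<1}. hausdorff_dim (level_set P Q w) = ereal \<alpha>}"


section \<open>Nice growth\<close>

definition triangular :: "nat \<Rightarrow> nat" where
  "triangular n = n * (n + 1) div 2"

definition grows_nicely :: "(nat \<Rightarrow> real) \<Rightarrow> bool" where
  "grows_nicely s \<longleftrightarrow>
     (\<exists>N. mono_on {N..} s) \<and>
     filterlim s at_top sequentially \<and>
     (\<lambda>n. ln (s (triangular (n + 2))) / ln (s (triangular n))) \<longlonglongrightarrow> 1"


section \<open>Existence and uniqueness of the Cantor series expansion\<close>

context
  fixes P :: "nat \<Rightarrow> int"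
  assumes P: "basic_sequence P"
begin

private definition D :: "nat \<Rightarrow> real" where
  "D n = real_of_int (\<Prod>k=1..n. P k)"

private lemma P_ge: "2 \<le> P (Suc n)"
  using P by (simp add: basic_sequence_def)

private lemma D_Suc: "D (Suc n) = D n * real_of_int (P (Suc n))"
  by (simp add: D_def prod.nat_ivl_Suc' mult.commute)

private lemma D_0: "D 0 = 1"
  by (simp add: D_def)

private lemma cantor_expansion_D:
  "cantor_expansion P x E \<longleftrightarrow>
     E 0 = \<lfloor>x\<rfloor> \<and> (\<forall>n\<ge>1. E n \<in> {0..P n - 1}) \<and> (\<exists>\<^sub>\<infinity>n. E n \<noteq> P n - 1) \<and>
     (\<lambda>n. real_of_int (E (Suc n)) / D (Suc n)) sums (x - real_of_int (E 0))"
  by (simp only: cantor_expansion_def D_def)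

private lemma D_ge: "2 ^ n \<le> D n"
proof (induction n)
  case (Suc n)
  have "(2::real) ^ n * 2 \<le> D n * real_of_int (P (Suc n))"
    by (intro mult_mono Suc) (use P_ge[of n] order_trans[OF _ Suc, of 0] in auto)
  then show ?case by (simp only: D_Suc power_Suc2)
qed (simp add: D_0)

private lemma D_pos: "0 < D n"
  by (rule less_le_trans[OF _ D_ge]) simp

private lemma D_inverse_tendsto: "(\<lambda>n. 1 / D n) \<longlonglongrightarrow> 0"
proof (rule tendsto_sandwich[where f = "\<lambda>_. 0" and h = "\<lambda>n. (1 / 2) ^ n"])
  show "(\<lambda>n. (1 / 2 :: real) ^ n) \<longlonglongrightarrow> 0"
    by (rule LIMSEQ_realpow_zero) auto
  show "\<forall>\<^sub>F n in sequentially. 1 / D n \<le> (1 / 2) ^ n"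
    using D_ge by (intro always_eventually allI) (simp add: power_one_over frac_le)
  show "\<forall>\<^sub>F n in sequentially. 0 \<le> 1 / D n"
    using D_pos by (intro always_eventually allI) (simp add: less_imp_le)
qed auto

private lemma max_digit: "real_of_int (P (Suc n) - 1) / D (Suc n) = 1 / D n - 1 / D (Suc n)"
  unfolding D_Suc using D_pos[of n] P_ge[of n] by (simp add: field_simps)

private lemma max_tail:
  "(\<lambda>i. real_of_int (P (Suc (i + n)) - 1) / D (Suc (i + n))) sums (1 / D n)"
proof -
  have "(\<lambda>i. 1 / D (i + n)) \<longlonglongrightarrow> 0"
    using LIMSEQ_ignore_initial_segment[OF D_inverse_tendsto] .
  from telescope_sums'[OF this] show ?thesis
    by (simp only: max_digit add_Suc add_0 diff_zero)
qed

private fun S :: "(nat \<Rightarrow> int) \<Rightarrow> nat \<Rightarrow> int" where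
  "S E 0 = 0"
| "S E (Suc n) = P (Suc n) * S E n + E (Suc n)"

private lemma partial_sum: "(\<Sum>i<n. real_of_int (E (Suc i)) / D (Suc i)) = real_of_int (S E n) / D n"
proof (induction n)
  case (Suc n)
  then show ?case
    unfolding sum.lessThan_Suc Suc D_Suc S.simps using D_pos[of n] P_ge[of n]
    by (simp add: field_simps)
qed simp

private lemma floor_S:
  assumes "cantor_expansion P x E"
  shows "\<lfloor>(x - real_of_int \<lfloor>x\<rfloor>) * D n\<rfloor> = S E n"
proof -
  let ?e = "\<lambda>i. real_of_int (E (Suc i)) / D (Suc i)"
  let ?y = "x - real_of_int \<lfloor>x\<rfloor>"
  have dig: "0 \<le> E (Suc i)" "E (Suc i) \<le> P (Suc i) - 1" for i
    using assms unfolding cantor_expansion_D by auto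
  have "?e sums ?y"
    using assms unfolding cantor_expansion_D by metis
  from sums_split_initial_segment[OF this, of n]
  have tail: "(\<lambda>i. ?e (i + n)) sums (?y - real_of_int (S E n) / D n)"
    unfolding partial_sum by simp
  have "0 \<le> ?y - real_of_int (S E n) / D n"
    by (rule sums_le[OF _ sums_zero tail]) (use dig(1) D_pos in \<open>auto intro!: divide_nonneg_pos\<close>)
  moreover have "?y - real_of_int (S E n) / D n < 1 / D n"
  proof -
    let ?d = "\<lambda>i. real_of_int (P (Suc (i + n)) - 1) / D (Suc (i + n)) - ?e (i + n)"
    have sd: "?d sums (1 / D n - (?y - real_of_int (S E n) / D n))"
      by (rule sums_diff[OF max_tail tail])
    obtain m where m: "m > n" "E m \<noteq> P m - 1"
      using assms unfolding cantor_expansion_D INFM_nat by blast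
    define j where "j = m - Suc n"
    have j: "m = Suc (j + n)" using m by (simp add: j_def)
    have d: "?d i = real_of_int (P (Suc (i + n)) - 1 - E (Suc (i + n))) / D (Suc (i + n))" for i
      by (simp add: diff_divide_distrib)
    have "0 < suminf ?d"
    proof (rule suminf_pos2[where i = j])
      show "summable ?d" using sd by (rule sums_summable)
      show "0 \<le> ?d i" for i
        unfolding d using dig(2)[of "i + n"] D_pos by (intro divide_nonneg_pos) auto
      show "0 < ?d j"
        unfolding d using dig(2)[of "j + n"] D_pos m j by (intro divide_pos_pos) auto
    qed
    then show ?thesis using sums_unique[OF sd] by simp
  qed
  ultimately have "real_of_int (S E n) / D n \<le> ?y" "?y < (real_of_int (S E n) + 1) / D n"
    by (simp_all add: add_divide_distrib)
  then show ?thesis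
    using D_pos[of n] by (intro floor_unique) (simp_all add: pos_divide_le_eq pos_less_divide_eq)
qed

lemma ex1_cantor_expansion: "\<exists>!E. cantor_expansion P x E"
proof (rule ex_ex1I)
  fix E E' assume *: "cantor_expansion P x E" "cantor_expansion P x E'"
  then have "S E n = S E' n" for n
    using floor_S by metis
  then have "E (Suc n) = E' (Suc n)" for n
    by (metis S.simps(2) add_left_cancel)
  moreover have "E 0 = E' 0"
    using * unfolding cantor_expansion_D by simp
  ultimately show "E = E'"
    by (metis ext not0_implies_Suc)
next
  define y where "y = x - real_of_int \<lfloor>x\<rfloor>"
  define F where "F n = \<lfloor>y * D n\<rfloor>" for n
  define E where "E n = (case n of 0 \<Rightarrow> \<lfloor>x\<rfloor> | Suc m \<Rightarrow> F (Suc m) - P (Suc m) * F m)" for n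
  have y: "0 \<le> y" "y < 1" by (auto simp: y_def, linarith)
  have S: "S E n = F n" for n
  proof (induction n)
    case 0
    then show ?case using y by (simp add: F_def D_0 floor_eq_iff)
  qed (simp add: E_def)
  have F: "real_of_int (F n) \<le> y * D n" "y * D n < real_of_int (F n) + 1" for n
    by (simp_all add: F_def)
  have dig: "E (Suc n) \<in> {0..P (Suc n) - 1}" for n
  proof -
    have p: "0 < real_of_int (P (Suc n))" using P_ge[of n] by simp
    have "real_of_int (P (Suc n) * F n) \<le> y * D (Suc n)"
      using mult_left_mono[OF F(1)[of n] less_imp_le[OF p]] unfolding D_Suc
      by (simp add: mult_ac)
    then have 1: "P (Suc n) * F n \<le> F (Suc n)"
      unfolding F_def[of "Suc n"] by (simp add: le_floor_iff)
    have "y * D (Suc n) < real_of_int (P (Suc n) * F n + P (Suc n))"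
      using mult_strict_left_mono[OF F(2)[of n] p] unfolding D_Suc
      by (simp add: algebra_simps)
    then have "F (Suc n) < P (Suc n) * F n + P (Suc n)"
      unfolding F_def[of "Suc n"] by (simp add: floor_less_iff)
    with 1 show ?thesis by (simp add: E_def)
  qed
  have sums: "(\<lambda>n. real_of_int (E (Suc n)) / D (Suc n)) sums y"
    unfolding sums_def partial_sum S
  proof (rule tendsto_sandwich)
    show "(\<lambda>n. y - 1 / D n) \<longlonglongrightarrow> y"
      using tendsto_diff[OF tendsto_const D_inverse_tendsto, of y] by simp
    show "\<forall>\<^sub>F n in sequentially. y - 1 / D n \<le> real_of_int (F n) / D n"
    proof (intro always_eventually allI)
      fix n
      have "y \<le> (real_of_int (F n) + 1) / D n"
        using F(2)[of n] D_pos[of n] by (simp add: pos_le_divide_eq)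
      then show "y - 1 / D n \<le> real_of_int (F n) / D n"
        by (simp add: add_divide_distrib)
    qed
    show "\<forall>\<^sub>F n in sequentially. real_of_int (F n) / D n \<le> y"
      using F(1) D_pos by (intro always_eventually allI) (simp add: field_simps)
  qed auto
  have "\<exists>\<^sub>\<infinity>n. E n \<noteq> P n - 1"
  proof (rule ccontr)
    assume "\<not> ?thesis"
    then obtain n where n: "\<And>m. m > n \<Longrightarrow> E m = P m - 1"
      unfolding INFM_nat by blast
    have "(\<lambda>i. real_of_int (E (Suc (i + n))) / D (Suc (i + n))) sums (1 / D n)"
      using max_tail[of n] n by simp
    moreover have "(\<lambda>i. real_of_int (E (Suc (i + n))) / D (Suc (i + n))) sums (y - real_of_int (F n) / D n)"
      using sums_split_initial_segment[OF sums, of n] unfolding partial_sum S by simp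
    ultimately have "1 / D n = y - real_of_int (F n) / D n"
      by (rule sums_unique2)
    then show False
      using F(2)[of n] D_pos[of n] by (simp add: field_simps)
  qed
  moreover have "\<forall>n\<ge>1. E n \<in> {0..P n - 1}"
    using dig by (metis One_nat_def Suc_le_D)
  moreover have "E 0 = \<lfloor>x\<rfloor>" by (simp add: E_def)
  ultimately have "cantor_expansion P x E"
    using sums unfolding cantor_expansion_D y_def by (intro conjI) simp_all
  then show "\<exists>E. cantor_expansion P x E" by (rule exI[where x = E])
qed

lemma cantor_expansion_digits: "cantor_expansion P x (cantor_digits P x)"
  unfolding cantor_digits_def by (rule theI'[OF ex1_cantor_expansion])

end

end

theory Submission
  imports Defs
begin

text \<open>
  If the \<open>Q\<close>-digits \<open>F\<close> of \<open>w\<close> are neither eventually \<open>0\<close> nor eventually \<open>q\<^sub>n - 1\<close>, the level set of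
  \<open>w\<close> consists of the numbers whose \<open>P\<close>-digits agree with \<open>F\<close>, except that the digit is free in
  \<open>{q\<^sub>n - 1..p\<^sub>n - 1}\<close> where \<open>F n = q\<^sub>n - 1\<close>. Prescribe \<open>F n = q\<^sub>n - 1\<close> on a set \<open>S\<close> of density
  \<open>\<delta> = \<alpha> / \<gamma>\<close>, and let \<open>F n\<close> range over \<open>{1..q\<^sub>n - 2}\<close> (\<open>F n = 0\<close> if \<open>q\<^sub>n = 2\<close>) off \<open>S\<close>. Then every level set has dimension
  \<open>\<delta> * \<gamma> = \<alpha>\<close>, while the set of such \<open>w\<close> has dimension \<open>1 - \<delta>\<close>. Taking for \<open>S\<close> the jumps of
  \<open>\<lfloor>\<delta> * n\<rfloor>\<close> keeps the discrepancy bounded, so Abel summation turns the density into these dimensions.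

  Both dimensions are instances of one formula. If the \<open>n\<close>-th digit ranges over an interval of
  \<open>m\<^sub>n < p\<^sub>n\<close> digits, and \<open>M\<^sub>n\<close>, \<open>D\<^sub>n\<close> are the products of the first \<open>n\<close> terms of \<open>m\<close> and \<open>P\<close>, the
  dimension is \<open>lim (ln M\<^sub>n / ln D\<^sub>n)\<close>, provided \<open>ln p\<^sub>n / ln D\<^sub>n\<close> tends to \<open>0\<close>. Covering by \<open>M\<^sub>n\<close>
  intervals of length \<open>1 / D\<^sub>n\<close> gives the upper bound. For the lower bound, reading the digits in base
  \<open>m\<close> maps the set onto \<open>[0, 1)\<close>; this map is Hoelder continuous because \<open>m\<^sub>n < p\<^sub>n\<close> separates two points
  first differing at digit \<open>n\<close> by at least \<open>1 / D\<^sub>(\<^sub>n\<^sub>+\<^sub>1\<^sub>)\<close>, so Lebesgue measure bounds Hausdorff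
  measure from below.
\<close>

section \<open>Cantor series with arbitrary bases\<close>

definition cantor_denom :: "(nat \<Rightarrow> int) \<Rightarrow> nat \<Rightarrow> real" where
  "cantor_denom P n = real_of_int (\<Prod>k=1..n. P k)"

definition cantor_value :: "(nat \<Rightarrow> int) \<Rightarrow> (nat \<Rightarrow> int) \<Rightarrow> real" where
  "cantor_value P E = (\<Sum>n. real_of_int (E (Suc n)) / cantor_denom P (Suc n))"

text \<open>A block of length 1 prescribes the digit, so this one family contains both the level
  sets and the set of values \<open>w\<close> to be constructed.\<close>

definition digit_set :: "(nat \<Rightarrow> int) \<Rightarrow> (nat \<Rightarrow> int) \<Rightarrow> (nat \<Rightarrow> int) \<Rightarrow> real set" where
  "digit_set P a m = {cantor_value P E |E. \<forall>n\<ge>1. E n \<in> {a n..<a n + m n}}"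

lemma cantor_denom_0 [simp]: "cantor_denom P 0 = 1"
  by (simp add: cantor_denom_def)

lemma cantor_denom_Suc: "cantor_denom P (Suc n) = cantor_denom P n * real_of_int (P (Suc n))"
  by (simp add: cantor_denom_def prod.nat_ivl_Suc' mult.commute)

lemma cantor_value_cong:
  assumes "\<And>n. 1 \<le> n \<Longrightarrow> E n = F n"
  shows "cantor_value P E = cantor_value P F"
  unfolding cantor_value_def using assms by simp

locale cantor_base =
  fixes P :: "nat \<Rightarrow> int"
  assumes base_ge_1: "1 \<le> n \<Longrightarrow> 1 \<le> P n"
    and denom_at_top: "filterlim (cantor_denom P) at_top sequentially"
begin

lemma denom_pos [simp]: "0 < cantor_denom P n"
proof (induction n)
  case (Suc n)
  then show ?case
    using base_ge_1[of "Suc n"] by (simp add: cantor_denom_Suc)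
qed simp

lemma denom_nonzero [simp]: "cantor_denom P n \<noteq> 0"
  by (metis denom_pos less_irrefl)

lemma inverse_denom_tendsto: "(\<lambda>n. 1 / cantor_denom P n) \<longlonglongrightarrow> 0"
  using tendsto_inverse_0_at_top[OF denom_at_top] by (simp add: inverse_eq_divide)

lemma max_tail_sums:
  "(\<lambda>i. real_of_int (P (Suc (i + n)) - 1) / cantor_denom P (Suc (i + n)))
     sums (1 / cantor_denom P n)"
proof -
  have "(\<lambda>i. 1 / cantor_denom P (i + n)) \<longlonglongrightarrow> 0"
    using LIMSEQ_ignore_initial_segment[OF inverse_denom_tendsto] .
  from telescope_sums'[OF this]
  have "(\<lambda>i. 1 / cantor_denom P (i + n) - 1 / cantor_denom P (Suc i + n))
          sums (1 / cantor_denom P n)" by simp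
  moreover have "1 / cantor_denom P (i + n) - 1 / cantor_denom P (Suc i + n) =
      real_of_int (P (Suc (i + n)) - 1) / cantor_denom P (Suc (i + n))" for i
    using base_ge_1[of "Suc (i + n)"] by (simp add: cantor_denom_Suc field_simps)
  ultimately show ?thesis by simp
qed

text \<open>Digits may be negative, so that the difference of two expansions is again such a series;
  comparing two values then amounts to bounding one.\<close>

lemma summable_digits:
  assumes "\<And>n. 1 \<le> n \<Longrightarrow> \<bar>d n\<bar> \<le> P n - 1"
  shows "summable (\<lambda>n. real_of_int (d (Suc n)) / cantor_denom P (Suc n))"
proof (rule summable_comparison_test')
  show "summable (\<lambda>n. real_of_int (P (Suc n) - 1) / cantor_denom P (Suc n))"
    using max_tail_sums[of 0] by (auto dest: sums_summable)
  show "norm (real_of_int (d (Suc n)) / cantor_denom P (Suc n))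
          \<le> real_of_int (P (Suc n) - 1) / cantor_denom P (Suc n)" if "n \<ge> 0" for n
  proof -
    have "real_of_int \<bar>d (Suc n)\<bar> \<le> real_of_int (P (Suc n) - 1)"
      using assms[of "Suc n"] by (intro of_int_le_iff[THEN iffD2]) simp
    then show ?thesis
      using denom_pos[of "Suc n"] by (simp add: divide_right_mono less_imp_le)
  qed
qed

lemma cantor_value_split:
  assumes "\<And>n. 1 \<le> n \<Longrightarrow> \<bar>d n\<bar> \<le> P n - 1"
  shows "cantor_value P d = (\<Sum>i<N. real_of_int (d (Suc i)) / cantor_denom P (Suc i))
           + (\<Sum>i. real_of_int (d (Suc (i + N))) / cantor_denom P (Suc (i + N)))"
  unfolding cantor_value_def
  using suminf_split_initial_segment[OF summable_digits[of d, OF assms], of N] by simp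

lemma cantor_value_diff:
  assumes "\<And>n. 1 \<le> n \<Longrightarrow> \<bar>d n\<bar> \<le> P n - 1" "\<And>n. 1 \<le> n \<Longrightarrow> \<bar>e n\<bar> \<le> P n - 1"
  shows "cantor_value P d - cantor_value P e = cantor_value P (\<lambda>n. d n - e n)"
  unfolding cantor_value_def
  using suminf_diff[OF summable_digits[of d, OF assms(1)] summable_digits[of e, OF assms(2)]]
  by (simp add: diff_divide_distrib)

lemma cantor_value_minus: "cantor_value P (\<lambda>n. - d n) = - cantor_value P d"
  if "\<And>n. 1 \<le> n \<Longrightarrow> \<bar>d n\<bar> \<le> P n - 1"
  unfolding cantor_value_def using suminf_minus[OF summable_digits[of d, OF that]] by simp

section \<open>Comparing values at the first differing digit\<close>

lemma tail_le:
  assumes d: "\<And>n. 1 \<le> n \<Longrightarrow> \<bar>d n\<bar> \<le> P n - 1"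
  shows "(\<Sum>i. real_of_int (d (Suc (i + N))) / cantor_denom P (Suc (i + N))) \<le> 1 / cantor_denom P N"
proof -
  have "summable (\<lambda>i. real_of_int (d (Suc (i + N))) / cantor_denom P (Suc (i + N)))"
    using summable_ignore_initial_segment[OF summable_digits[of d, OF d], of N] by simp
  moreover have "real_of_int (d (Suc (i + N))) / cantor_denom P (Suc (i + N))
      \<le> real_of_int (P (Suc (i + N)) - 1) / cantor_denom P (Suc (i + N))" for i
    using d[of "Suc (i + N)"] by (intro divide_right_mono of_int_le_iff[THEN iffD2])
      (auto simp: less_imp_le)
  ultimately show ?thesis
    using suminf_le[OF _ _ sums_summable[OF max_tail_sums[of N]]] sums_unique[OF max_tail_sums[of N]]
    by simp
qed

text \<open>Raising digit \<open>j\<close> by one keeps the digits admissible and adds exactly 1 /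
  D_j to the tail. The bound \<open>tail_le\<close> for the raised sequence leaves this gap.\<close>

lemma tail_gap:
  assumes d: "\<And>n. 1 \<le> n \<Longrightarrow> \<bar>d n\<bar> \<le> P n - 1" and j: "N < j" "d j \<le> P j - 2"
  shows "(\<Sum>i. real_of_int (d (Suc (i + N))) / cantor_denom P (Suc (i + N)))
           \<le> 1 / cantor_denom P N - 1 / cantor_denom P j"
proof -
  let ?f = "\<lambda>i. real_of_int (d (Suc (i + N))) / cantor_denom P (Suc (i + N))"
  define e where "e = d(j := d j + 1)"
  have e: "\<bar>e n\<bar> \<le> P n - 1" if "1 \<le> n" for n
    using d[OF that] j by (auto simp: e_def)
  define k where "k = j - Suc N"
  have k: "j = Suc (k + N)" using j by (simp add: k_def)
  have sf: "summable ?f"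
    using summable_ignore_initial_segment[OF summable_digits[of d, OF d], of N] by simp
  have eq: "real_of_int (e (Suc (i + N))) / cantor_denom P (Suc (i + N))
      = ?f i + (if i = k then 1 / cantor_denom P j else 0)" for i
    using k by (auto simp: e_def add_divide_distrib)
  have "(\<Sum>i. ?f i) + 1 / cantor_denom P j
      = (\<Sum>i. ?f i + (if i = k then 1 / cantor_denom P j else 0))"
    using suminf_add[OF sf sums_summable[OF sums_single[of k "\<lambda>_. 1 / cantor_denom P j"]]]
      sums_unique[OF sums_single[of k "\<lambda>_. 1 / cantor_denom P j"]] by simp
  also have "\<dots> \<le> 1 / cantor_denom P N"
    using tail_le[of e N, OF e] unfolding eq by simp
  finally show ?thesis by simp
qed

lemma value_le_of_agree:
  assumes d: "\<And>n. 1 \<le> n \<Longrightarrow> \<bar>d n\<bar> \<le> P n - 1"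
    and z: "\<And>n. 1 \<le> n \<Longrightarrow> n \<le> N \<Longrightarrow> d n = 0"
  shows "\<bar>cantor_value P d\<bar> \<le> 1 / cantor_denom P N"
proof -
  have *: "cantor_value P e \<le> 1 / cantor_denom P N"
    if e: "\<And>n. 1 \<le> n \<Longrightarrow> \<bar>e n\<bar> \<le> P n - 1" and z: "\<And>n. 1 \<le> n \<Longrightarrow> n \<le> N \<Longrightarrow> e n = 0" for e
  proof -
    have "(\<Sum>i<N. real_of_int (e (Suc i)) / cantor_denom P (Suc i)) = 0"
      using z by (intro sum.neutral) auto
    then show ?thesis
      using cantor_value_split[of e N, OF e] tail_le[of e N, OF e] by simp
  qed
  have "cantor_value P (\<lambda>n. - d n) \<le> 1 / cantor_denom P N"
    by (rule *) (use d z in auto)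
  then show ?thesis
    using *[of d, OF d z] cantor_value_minus[of d, OF d] by simp
qed

text \<open>The first nonzero digit is at most -1 and contributes at most -1 / D_(N+1). By
  \<open>tail_gap\<close> the later digits fall short of making up for it by at least 1 /
  D_j.\<close>

lemma value_le_neg:
  assumes d: "\<And>n. 1 \<le> n \<Longrightarrow> \<bar>d n\<bar> \<le> P n - 1"
    and z: "\<And>n. 1 \<le> n \<Longrightarrow> n \<le> N \<Longrightarrow> d n = 0"
    and neg: "d (Suc N) < 0" and j: "Suc N < j" "d j \<le> P j - 2"
  shows "cantor_value P d \<le> - (1 / cantor_denom P j)"
proof -
  have "(\<Sum>i<Suc N. real_of_int (d (Suc i)) / cantor_denom P (Suc i))
      = real_of_int (d (Suc N)) / cantor_denom P (Suc N)"
    using z by (simp add: sum.neutral)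
  also have "\<dots> \<le> - 1 / cantor_denom P (Suc N)"
    using neg by (intro divide_right_mono) (auto simp: less_imp_le)
  finally show ?thesis
    using cantor_value_split[of d "Suc N", OF d] tail_gap[of d "Suc N" j, OF d j] by simp
qed

text \<open>The sequence with the smaller digit at the first differing place can catch up only if
  every later difference is the maximal \<open>P j - 1\<close>. This forces
  \<open>F j = P j - 1\<close> from there on if \<open>F\<close> is the smaller one, and
  \<open>F j = 0\<close> if \<open>G\<close> is. The conditions on \<open>F\<close> exclude both, so
  \<open>G\<close> may be any admissible digit sequence.\<close>

lemma value_unique:
  assumes F: "\<And>n. 1 \<le> n \<Longrightarrow> F n \<in> {0..P n - 1}" and G: "\<And>n. 1 \<le> n \<Longrightarrow> G n \<in> {0..P n - 1}"
    and F0: "\<exists>\<^sub>\<infinity>n. F n \<noteq> 0" and F1: "\<exists>\<^sub>\<infinity>n. F n \<noteq> P n - 1"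
    and eq: "cantor_value P F = cantor_value P G" and n: "1 \<le> n"
  shows "F n = G n"
proof (rule ccontr)
  assume "F n \<noteq> G n"
  define k where "k = (LEAST k. F (Suc k) \<noteq> G (Suc k))"
  have "F (Suc (n - 1)) \<noteq> G (Suc (n - 1))" using \<open>F n \<noteq> G n\<close> n by simp
  then have k: "F (Suc k) \<noteq> G (Suc k)"
    unfolding k_def by (rule LeastI)
  have z: "F i = G i" if "1 \<le> i" "i \<le> k" for i
    using not_less_Least[of "i - 1" "\<lambda>k. F (Suc k) \<noteq> G (Suc k)"] that by (auto simp: k_def)
  have b: "\<bar>F i\<bar> \<le> P i - 1" "\<bar>G i\<bar> \<le> P i - 1" "\<bar>F i - G i\<bar> \<le> P i - 1" "\<bar>G i - F i\<bar> \<le> P i - 1"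
    if "1 \<le> i" for i
    using F[OF that] G[OF that] by auto
  show False
  proof (cases "F (Suc k) < G (Suc k)")
    case True
    obtain j where j: "Suc k < j" "F j \<noteq> P j - 1" using F1 unfolding INFM_nat by blast
    then have "F j - G j \<le> P j - 2" using F[of j] G[of j] by auto
    then have "cantor_value P (\<lambda>i. F i - G i) \<le> - (1 / cantor_denom P j)"
      using value_le_neg[of "\<lambda>i. F i - G i" k j] b(3) z True j by auto
    then show False
      using cantor_value_diff[of F G, OF b(1,2)] eq denom_pos[of j] by (simp add: field_simps)
  next
    case False
    obtain j where j: "Suc k < j" "F j \<noteq> 0" using F0 unfolding INFM_nat by blast
    then have "G j - F j \<le> P j - 2" using F[of j] G[of j] by auto
    then have "cantor_value P (\<lambda>i. G i - F i) \<le> - (1 / cantor_denom P j)"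
      using value_le_neg[of "\<lambda>i. G i - F i" k j] b(4) z False k j by auto
    then show False
      using cantor_value_diff[of G F, OF b(2,1)] eq denom_pos[of j] by (simp add: field_simps)
  qed
qed

lemma value_bounds:
  assumes E: "\<And>n. 1 \<le> n \<Longrightarrow> E n \<in> {0..P n - 1}"
    and E0: "\<exists>\<^sub>\<infinity>n. E n \<noteq> 0" and E1: "\<exists>\<^sub>\<infinity>n. E n \<noteq> P n - 1"
  shows "0 < cantor_value P E" "cantor_value P E < 1"
proof -
  have b: "\<bar>E i\<bar> \<le> P i - 1" if "1 \<le> i" for i using E[OF that] by auto
  obtain j where j: "0 < j" "E j \<noteq> P j - 1" using E1 unfolding INFM_nat by blast
  then have "E j \<le> P j - 2" using E[of j] by auto
  then have "cantor_value P E \<le> 1 - 1 / cantor_denom P j"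
    using cantor_value_split[of E 0, OF b] tail_gap[of E 0 j, OF b j(1)] by simp
  moreover have "0 < 1 / cantor_denom P j" by simp
  ultimately show "cantor_value P E < 1" by linarith
  obtain j where j: "0 < j" "E j \<noteq> 0" using E0 unfolding INFM_nat by blast
  show "0 < cantor_value P E"
    unfolding cantor_value_def
  proof (rule suminf_pos2[where i = "j - 1"])
    show "summable (\<lambda>n. real_of_int (E (Suc n)) / cantor_denom P (Suc n))"
      by (rule summable_digits) (rule b)
    show "0 \<le> real_of_int (E (Suc n)) / cantor_denom P (Suc n)" for n
      using E[of "Suc n"] by (simp add: less_imp_le)
    show "0 < real_of_int (E (Suc (j - 1))) / cantor_denom P (Suc (j - 1))"
      using E[of j] j by simp
  qed
qed

section \<open>Greedy digits of a point of [0, 1)\<close>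

definition floor_digits :: "real \<Rightarrow> nat \<Rightarrow> int" where
  "floor_digits y n = \<lfloor>y * cantor_denom P n\<rfloor> - P n * \<lfloor>y * cantor_denom P (n - 1)\<rfloor>"

lemma floor_digits_range:
  assumes "1 \<le> n"
  shows "floor_digits y n \<in> {0..<P n}"
proof -
  obtain k where n: "n = Suc k" using assms by (cases n) auto
  let ?D = "cantor_denom P k"
  have p: "0 < real_of_int (P n)" using base_ge_1[OF assms] by simp
  have D: "cantor_denom P n = ?D * P n" by (simp add: n cantor_denom_Suc)
  have "real_of_int (P n) * \<lfloor>y * ?D\<rfloor> \<le> real_of_int (P n) * (y * ?D)"
    using p by (intro mult_left_mono) auto
  then have 1: "P n * \<lfloor>y * ?D\<rfloor> \<le> \<lfloor>y * cantor_denom P n\<rfloor>"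
    by (simp add: D le_floor_iff mult_ac)
  have "real_of_int (P n) * (y * ?D) < real_of_int (P n) * (real_of_int \<lfloor>y * ?D\<rfloor> + 1)"
    using p by (intro mult_strict_left_mono) auto
  then have "\<lfloor>y * cantor_denom P n\<rfloor> < P n * \<lfloor>y * ?D\<rfloor> + P n"
    by (simp add: D floor_less_iff algebra_simps)
  with 1 show ?thesis by (simp add: floor_digits_def n)
qed

text \<open>The floor of \<open>y * D n\<close> is the numerator of the \<open>n\<close>-th partial
  sum over D_n, so that sum is within 1 / D_n of \<open>y\<close>. For \<open>n = 0\<close> this
  uses that \<open>y\<close> has floor 0.\<close>

lemma value_floor_digits:
  assumes y: "y \<in> {0..<1}"
  shows "cantor_value P (floor_digits y) = y"
proof -
  let ?D = "cantor_denom P"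
  have part: "(\<Sum>i<n. real_of_int (floor_digits y (Suc i)) / ?D (Suc i)) = \<lfloor>y * ?D n\<rfloor> / ?D n" for n
  proof (induction n)
    case 0
    then show ?case using y by (simp add: floor_eq_iff)
  next
    case (Suc n)
    have "real_of_int (P (Suc n)) \<noteq> 0" using base_ge_1[of "Suc n"] by simp
    then have "\<lfloor>y * ?D n\<rfloor> / ?D n = P (Suc n) * \<lfloor>y * ?D n\<rfloor> / ?D (Suc n)"
      by (simp add: cantor_denom_Suc)
    with Suc show ?case by (simp add: floor_digits_def flip: add_divide_distrib)
  qed
  have "(\<lambda>n. \<lfloor>y * ?D n\<rfloor> / ?D n) \<longlonglongrightarrow> y"
  proof (rule tendsto_sandwich)
    show "(\<lambda>n. y - 1 / ?D n) \<longlonglongrightarrow> y"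
      using tendsto_diff[OF tendsto_const inverse_denom_tendsto, of y] by simp
    show "\<forall>\<^sub>F n in sequentially. y - 1 / ?D n \<le> \<lfloor>y * ?D n\<rfloor> / ?D n"
    proof (intro always_eventually allI)
      fix n
      have "(y * ?D n - 1) / ?D n \<le> \<lfloor>y * ?D n\<rfloor> / ?D n"
        by (intro divide_right_mono) (use denom_pos[of n] in linarith)+
      then show "y - 1 / ?D n \<le> \<lfloor>y * ?D n\<rfloor> / ?D n" by (simp add: diff_divide_distrib)
    qed
    show "\<forall>\<^sub>F n in sequentially. \<lfloor>y * ?D n\<rfloor> / ?D n \<le> y"
      by (intro always_eventually allI) (simp add: pos_divide_le_eq)
  qed simp
  then have "(\<lambda>n. real_of_int (floor_digits y (Suc n)) / ?D (Suc n)) sums y"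
    unfolding sums_def part .
  then show ?thesis unfolding cantor_value_def by (simp add: sums_iff)
qed

end

lemma cantor_base_basic:
  assumes "basic_sequence P"
  shows "cantor_base P"
proof
  show "1 \<le> P n" if "1 \<le> n" for n
    using assms that by (force simp: basic_sequence_def)
  have "2 ^ n \<le> cantor_denom P n" for n
  proof (induction n)
    case (Suc n)
    have "(2::real) ^ n * 2 \<le> cantor_denom P n * real_of_int (P (Suc n))"
      using assms order_trans[OF _ Suc, of 0]
      by (intro mult_mono Suc) (auto simp: basic_sequence_def)
    then show ?case by (simp add: cantor_denom_Suc)
  qed simp
  then have "real n \<le> cantor_denom P n" for n
    using of_nat_less_two_power[of n, where 'a = real] by (meson less_imp_le order_trans)
  then show "filterlim (cantor_denom P) at_top sequentially"
    by (intro filterlim_at_top_mono[OF filterlim_real_sequentially]) auto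
qed

section \<open>Bounds for Hausdorff measure\<close>

lemma hausdorff_measure_mono:
  assumes "A \<subseteq> B"
  shows "hausdorff_measure s A \<le> hausdorff_measure s B"
  unfolding hausdorff_measure_def
  by (intro SUP_mono' INF_superset_mono) (use assms in \<open>auto simp: delta_covers_def\<close>)

lemma hausdorff_dim_mono:
  assumes "A \<subseteq> B"
  shows "hausdorff_dim A \<le> hausdorff_dim B"
  unfolding hausdorff_dim_def
  by (rule Inf_superset_mono)
    (use hausdorff_measure_mono[OF assms] in \<open>auto simp flip: le_zero_eq intro: order_trans\<close>)

text \<open>Since all members share the diameter bound \<open>d\<close>, a cover costs at most
  \<open>real (card V) * d powr s\<close>. The one parameter \<open>e\<close> controls both mesh and
  cost.\<close>

lemma hausdorff_measure_zeroI:
  fixes A :: "'a::metric_space set"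
  assumes s: "0 < s"
    and cover: "\<And>e. 0 < e \<Longrightarrow> \<exists>V d. finite V \<and> 0 \<le> d \<and> d \<le> e \<and> A \<subseteq> \<Union>V \<and>
      (\<forall>U\<in>V. bounded U \<and> diameter U \<le> d) \<and> real (card V) * d powr s \<le> e"
  shows "hausdorff_measure s A = 0"
proof -
  have "(INF U\<in>delta_covers \<delta> A. \<Sum>i. hausdorff_gauge s (U i)) \<le> 0" if \<delta>: "0 < \<delta>" for \<delta>
  proof (rule ennreal_le_epsilon)
    fix e :: real assume e: "0 < e"
    obtain V d where V: "finite V" "0 \<le> d" "d \<le> min \<delta> e" "A \<subseteq> \<Union>V"
        "\<And>U. U \<in> V \<Longrightarrow> bounded U \<and> diameter U \<le> d" "real (card V) * d powr s \<le> min \<delta> e"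
      using cover[of "min \<delta> e"] \<delta> e by auto
    obtain xs where xs: "set xs = V" "distinct xs" using finite_distinct_list[OF V(1)] by blast
    \<comment> \<open>The finite family becomes a sequence by padding with empty sets, which have
      gauge 0.\<close>
    define U where "U i = (if i < length xs then xs ! i else {})" for i
    have mem: "U i \<in> V \<or> U i = {}" for i using xs by (auto simp: U_def)
    have "bounded (U i) \<and> diameter (U i) \<le> \<delta>" for i
      using mem[of i] V(3) V(5)[of "U i"] \<delta> by auto
    moreover have "A \<subseteq> (\<Union>i. U i)"
    proof
      fix x assume "x \<in> A"
      then obtain W where "W \<in> V" "x \<in> W" using V(4) by auto
      then obtain i where "i < length xs" "W = xs ! i" using xs by (auto simp: in_set_conv_nth)
      then have "x \<in> U i" using \<open>x \<in> W\<close> by (simp add: U_def)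
      then show "x \<in> (\<Union>i. U i)" by blast
    qed
    ultimately have "U \<in> delta_covers \<delta> A" by (simp add: delta_covers_def)
    then have "(INF U\<in>delta_covers \<delta> A. \<Sum>i. hausdorff_gauge s (U i)) \<le> (\<Sum>i. hausdorff_gauge s (U i))"
      by (rule INF_lower)
    also have "\<dots> = (\<Sum>i<length xs. hausdorff_gauge s (U i))"
      by (rule suminf_finite) (auto simp: U_def hausdorff_gauge_def)
    also have "\<dots> \<le> (\<Sum>i<length xs. ennreal (d powr s))"
    proof (rule sum_mono)
      fix i
      show "hausdorff_gauge s (U i) \<le> ennreal (d powr s)"
        using mem[of i] V(5)[of "U i"] s
        by (auto simp: hausdorff_gauge_def intro!: ennreal_leI powr_mono2 diameter_ge_0)
    qed
    also have "\<dots> = ennreal (real (card V) * d powr s)"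
      using xs distinct_card[of xs] by (simp add: ennreal_mult ennreal_of_nat_eq_real_of_nat)
    also have "\<dots> \<le> 0 + ennreal e" using V(6) by (auto intro!: ennreal_leI)
    finally show "(INF U\<in>delta_covers \<delta> A. \<Sum>i. hausdorff_gauge s (U i)) \<le> 0 + ennreal e" .
  qed
  then have "hausdorff_measure s A \<le> 0"
    unfolding hausdorff_measure_def by (intro SUP_least) auto
  then show ?thesis by simp
qed

text \<open>Lebesgue measure on [0, 1) acts as a mass distribution: the inverse Hoelder bound makes
  each piece of a cover pull back under \<open>g\<close> into an interval of length 2 C times its
  gauge. A cover of total gauge below 1 / (2 C) would give [0, 1) length less than 1.\<close>

lemma hausdorff_measure_nonzeroI:
  fixes g :: "real \<Rightarrow> 'a::metric_space"
  assumes s: "0 \<le> s" and C: "0 < C" and g: "g ` {0..<1} \<subseteq> A"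
    and holder: "\<And>y y'. y \<in> {0..<1} \<Longrightarrow> y' \<in> {0..<1} \<Longrightarrow> y \<noteq> y' \<Longrightarrow>
      \<bar>y - y'\<bar> \<le> C * dist (g y) (g y') powr s"
  shows "hausdorff_measure s A \<noteq> 0"
proof
  assume "hausdorff_measure s A = 0"
  then have "(INF U\<in>delta_covers 1 A. \<Sum>i. hausdorff_gauge s (U i)) \<le> 0"
    unfolding hausdorff_measure_def by (metis SUP_upper greaterThan_iff zero_less_one)
  also have "0 < ennreal (1 / (2 * C))" using C by simp
  finally obtain U where U: "U \<in> delta_covers 1 A"
      and less: "(\<Sum>i. hausdorff_gauge s (U i)) < ennreal (1 / (2 * C))"
    unfolding INF_less_iff by blast
  have bd: "bounded (U i)" for i using U by (auto simp: delta_covers_def)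
  \<comment> \<open>The pull-back need not be measurable, so it is enclosed in an interval centred
    at one of its points.\<close>
  have "\<exists>B. B \<in> sets lborel \<and> {y \<in> {0..<1}. g y \<in> U i} \<subseteq> B \<and>
      emeasure lborel B \<le> ennreal (2 * C) * hausdorff_gauge s (U i)" for i
  proof (cases "{y \<in> {0..<1}. g y \<in> U i} = {}")
    case True
    then show ?thesis by (intro exI[of _ "{}"]) auto
  next
    case False
    then obtain z where z: "z \<in> {0..<1}" "g z \<in> U i" by blast
    \<comment> \<open>This is the gauge of the nonempty set \<open>U i\<close>; at
      \<open>s = 0\<close> it is 1 whatever the diameter.\<close>
    define c where "c = (if s = 0 then 1 else diameter (U i) powr s)"
    have c0: "0 \<le> c" by (simp add: c_def)
    have gauge: "hausdorff_gauge s (U i) = ennreal c"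
      using z by (auto simp: hausdorff_gauge_def c_def)
    have "\<bar>y - z\<bar> \<le> C * c" if y: "y \<in> {0..<1}" "g y \<in> U i" for y
    proof (cases "y = z")
      case True
      then show ?thesis using C c0 by simp
    next
      case False
      have "dist (g y) (g z) powr s \<le> c"
        using s diameter_bounded_bound[OF bd y(2) z(2)]
        by (auto simp: c_def intro!: powr_mono2)
      then show ?thesis
        using holder[OF y(1) z(1) False] C by (meson less_imp_le mult_left_mono order_trans)
    qed
    then have "{y \<in> {0..<1}. g y \<in> U i} \<subseteq> {z - C * c..z + C * c}"
      by (auto simp: abs_le_iff algebra_simps)
    moreover have "emeasure lborel {z - C * c..z + C * c} = ennreal (2 * C) * hausdorff_gauge s (U i)"
      using C c0 by (simp add: gauge ennreal_mult[symmetric] algebra_simps)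
    ultimately show ?thesis by (intro exI[of _ "{z - C * c..z + C * c}"]) auto
  qed
  then obtain B where B: "\<And>i. B i \<in> sets lborel"
      "\<And>i. {y \<in> {0..<1}. g y \<in> U i} \<subseteq> B i"
      "\<And>i. emeasure lborel (B i) \<le> ennreal (2 * C) * hausdorff_gauge s (U i)"
    by metis
  have "{0..<1} \<subseteq> (\<Union>i. B i)"
  proof
    fix y :: real assume y: "y \<in> {0..<1}"
    then have "g y \<in> (\<Union>i. U i)" using g U unfolding delta_covers_def by blast
    then obtain i where "g y \<in> U i" by blast
    then show "y \<in> (\<Union>i. B i)" using B(2)[of i] y by blast
  qed
  then have "emeasure lborel {0..<1::real} \<le> emeasure lborel (\<Union>i. B i)"
    using B(1) by (intro emeasure_mono) auto
  also have "\<dots> \<le> (\<Sum>i. emeasure lborel (B i))"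
    using B(1) by (intro emeasure_subadditive_countably) auto
  also have "\<dots> \<le> (\<Sum>i. ennreal (2 * C) * hausdorff_gauge s (U i))"
    by (intro suminf_le B(3)) auto
  also have "\<dots> = ennreal (2 * C) * (\<Sum>i. hausdorff_gauge s (U i))"
    by simp
  also have "\<dots> < ennreal (2 * C) * ennreal (1 / (2 * C))"
    using less C by (intro ennreal_mult_strict_left_mono) auto
  also have "\<dots> = 1" using C by (simp add: ennreal_mult[symmetric])
  finally show False by simp
qed

section \<open>Covering digit sets by intervals of one level\<close>

context cantor_base
begin

text \<open>These are the left end points of the covering intervals of level \<open>n\<close>.
  Coinciding sums only lower the count, so different digit strings need not be separated.\<close>

primrec prefix_values :: "(nat \<Rightarrow> int) \<Rightarrow> (nat \<Rightarrow> int) \<Rightarrow> nat \<Rightarrow> real set" where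
  "prefix_values a m 0 = {0}"
| "prefix_values a m (Suc n) =
     (\<lambda>(z, e). z + real_of_int e / cantor_denom P (Suc n)) `
       (prefix_values a m n \<times> {a (Suc n)..<a (Suc n) + m (Suc n)})"

lemma finite_prefix_values: "finite (prefix_values a m n)"
  by (induction n) auto

lemma card_prefix_values:
  assumes "\<And>n. 1 \<le> n \<Longrightarrow> 1 \<le> m n"
  shows "real (card (prefix_values a m n)) \<le> cantor_denom m n"
proof (induction n)
  case (Suc n)
  have "card (prefix_values a m (Suc n))
      \<le> card (prefix_values a m n \<times> {a (Suc n)..<a (Suc n) + m (Suc n)})"
    unfolding prefix_values.simps by (intro card_image_le) (simp add: finite_prefix_values)
  from of_nat_mono[OF this, where 'a = real]
  have "real (card (prefix_values a m (Suc n)))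
      \<le> real (card (prefix_values a m n)) * real_of_int (m (Suc n))"
    using assms[of "Suc n"] by (simp add: card_cartesian_product del: prefix_values.simps)
  also have "\<dots> \<le> cantor_denom m (Suc n)"
    unfolding cantor_denom_Suc using assms[of "Suc n"] by (intro mult_right_mono Suc) auto
  finally show ?case .
qed simp

lemma partial_sum_in_prefix_values:
  assumes "\<And>n. 1 \<le> n \<Longrightarrow> E n \<in> {a n..<a n + m n}"
  shows "(\<Sum>i<n. real_of_int (E (Suc i)) / cantor_denom P (Suc i)) \<in> prefix_values a m n"
proof (induction n)
  case (Suc n)
  then show ?case using assms[of "Suc n"]
    by (auto intro!: image_eqI[where x = "(\<Sum>i<n. real_of_int (E (Suc i)) / cantor_denom P (Suc i), E (Suc n))"])
qed simp

text \<open>The digits after place \<open>n\<close> contribute between 0 and 1 / D_n to a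
  point.\<close>

lemma digit_set_cover:
  assumes m: "\<And>n. 1 \<le> n \<Longrightarrow> 1 \<le> m n" and a: "\<And>n. 1 \<le> n \<Longrightarrow> 0 \<le> a n"
    and am: "\<And>n. 1 \<le> n \<Longrightarrow> a n + m n \<le> P n"
  shows "\<exists>V. finite V \<and> real (card V) \<le> cantor_denom m n \<and> digit_set P a m \<subseteq> \<Union>V \<and>
    (\<forall>U\<in>V. bounded U \<and> diameter U \<le> 1 / cantor_denom P n)"
proof -
  let ?I = "\<lambda>z. {z..z + 1 / cantor_denom P n}"
  let ?V = "?I ` prefix_values a m n"
  have "real (card ?V) \<le> cantor_denom m n"
    using card_image_le[OF finite_prefix_values, of ?I a m n] card_prefix_values[of m a n] m
    by (meson of_nat_mono order_trans)
  moreover have "digit_set P a m \<subseteq> \<Union>?V"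
  proof
    fix x assume "x \<in> digit_set P a m"
    then obtain E where x: "x = cantor_value P E" and E: "\<And>n. 1 \<le> n \<Longrightarrow> E n \<in> {a n..<a n + m n}"
      by (auto simp: digit_set_def)
    have E0: "0 \<le> E n" "\<bar>E n\<bar> \<le> P n - 1" if "1 \<le> n" for n
      using E[OF that] a[OF that] am[OF that] by auto
    define z where "z = (\<Sum>i<n. real_of_int (E (Suc i)) / cantor_denom P (Suc i))"
    have "0 \<le> (\<Sum>i. real_of_int (E (Suc (i + n))) / cantor_denom P (Suc (i + n)))"
      using summable_ignore_initial_segment[OF summable_digits[of E, OF E0(2)], of n] E0(1)
      by (intro suminf_nonneg) (auto simp: less_imp_le)
    then have "x \<in> ?I z"
      using cantor_value_split[of E n, OF E0(2)] tail_le[of E n, OF E0(2)]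
      by (auto simp: x z_def)
    moreover have "z \<in> prefix_values a m n"
      unfolding z_def by (rule partial_sum_in_prefix_values) (rule E)
    ultimately show "x \<in> \<Union>?V" by blast
  qed
  ultimately show ?thesis
    by (intro exI[of _ ?V]) (auto simp: finite_prefix_values less_imp_le)
qed

end

section \<open>Dimension of sets with restricted digits\<close>

text \<open>For \<open>t\<close> strictly between \<open>v\<close> and \<open>s\<close>, M_n is
  eventually at most D_n to the power \<open>t\<close>. The cover of level \<open>n\<close> then
  costs at most D_n to the power \<open>t - s\<close>, which tends to 0.\<close>

lemma digit_set_measure_zero:
  assumes P: "cantor_base P"
    and m: "\<And>n. 1 \<le> n \<Longrightarrow> 1 \<le> m n" and a: "\<And>n. 1 \<le> n \<Longrightarrow> 0 \<le> a n"
    and am: "\<And>n. 1 \<le> n \<Longrightarrow> a n + m n \<le> P n"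
    and v: "(\<lambda>n. ln (cantor_denom m n) / ln (cantor_denom P n)) \<longlonglongrightarrow> v"
    and s: "0 < s" "v < s"
  shows "hausdorff_measure s (digit_set P a m) = 0"
proof (rule hausdorff_measure_zeroI)
  interpret cantor_base P by (rule P)
  fix e :: real assume e: "0 < e"
  obtain t where t: "v < t" "t < s" using dense[OF s(2)] by blast
  have "((\<lambda>n. cantor_denom P n powr (t - s)) \<longlongrightarrow> 0) sequentially"
    using t by (intro tendsto_neg_powr denom_at_top) simp
  then have 1: "\<forall>\<^sub>F n in sequentially. cantor_denom P n powr (t - s) < e"
    by (rule order_tendstoD) (rule e)
  have 2: "\<forall>\<^sub>F n in sequentially. 1 / cantor_denom P n < e"
    using order_tendstoD(2)[OF inverse_denom_tendsto e] .
  have 3: "\<forall>\<^sub>F n in sequentially. ln (cantor_denom m n) / ln (cantor_denom P n) < t"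
    using order_tendstoD(2)[OF v t(1)] .
  have 4: "\<forall>\<^sub>F n in sequentially. 1 < cantor_denom P n"
    using denom_at_top unfolding filterlim_at_top_dense by blast
  obtain n where n: "cantor_denom P n powr (t - s) < e" "1 / cantor_denom P n < e"
      "ln (cantor_denom m n) / ln (cantor_denom P n) < t" "1 < cantor_denom P n"
    using eventually_happens[OF eventually_conj[OF 1 eventually_conj[OF 2 eventually_conj[OF 3 4]]]]
    by auto
  have "0 < cantor_denom m n"
    unfolding cantor_denom_def using m by (force intro!: prod_pos)
  then have "cantor_denom m n \<le> cantor_denom P n powr t"
    using n(3,4) by (simp add: powr_def pos_divide_less_eq less_imp_le flip: ln_le_cancel_iff)
  then have "cantor_denom m n * (1 / cantor_denom P n) powr s
      \<le> cantor_denom P n powr t * (1 / cantor_denom P n) powr s"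
    by (rule mult_right_mono) simp
  also have "\<dots> = cantor_denom P n powr (t - s)"
    using n(4) by (simp add: powr_diff powr_divide)
  finally have small: "cantor_denom m n * (1 / cantor_denom P n) powr s \<le> e"
    using n(1) by simp
  obtain V where V: "finite V" "real (card V) \<le> cantor_denom m n" "digit_set P a m \<subseteq> \<Union>V"
      "\<forall>U\<in>V. bounded U \<and> diameter U \<le> 1 / cantor_denom P n"
    using digit_set_cover[of m a n] m a am by blast
  have "real (card V) * (1 / cantor_denom P n) powr s \<le> e"
    by (rule order_trans[OF mult_right_mono[OF V(2)] small]) simp
  then show "\<exists>V d. finite V \<and> 0 \<le> d \<and> d \<le> e \<and> digit_set P a m \<subseteq> \<Union>V \<and>
      (\<forall>U\<in>V. bounded U \<and> diameter U \<le> d) \<and> real (card V) * d powr s \<le> e"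
    using V n(2) by (intro exI[of _ V] exI[of _ "1 / cantor_denom P n"]) (auto simp: less_imp_le)
qed (rule s)

text \<open>The map \<open>g\<close> reads the base-\<open>m\<close> digits of \<open>y\<close> as
  offsets above \<open>a\<close>. Points first differing at place k + 1 are at most 1 / M_k apart,
  their images at least 1 / D_(k+2), so \<open>ev\<close> amounts to the inverse Hoelder bound with
  exponent \<open>s\<close>.\<close>

lemma digit_set_measure_nonzero:
  assumes P: "cantor_base P" and m: "cantor_base m" and a: "\<And>n. 1 \<le> n \<Longrightarrow> 0 \<le> a n"
    and am: "\<And>n. 1 \<le> n \<Longrightarrow> a n + m n \<le> P n" and mP: "\<And>n. 1 \<le> n \<Longrightarrow> m n \<le> P n - 1"
    and ev: "\<forall>\<^sub>F n in sequentially. cantor_denom P (n + 2) powr s \<le> cantor_denom m n"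
    and s: "0 \<le> s"
  shows "hausdorff_measure s (digit_set P a m) \<noteq> 0"
proof -
  interpret P: cantor_base P by (rule P)
  interpret m: cantor_base m by (rule m)
  obtain n0 where n0: "\<And>n. n0 \<le> n \<Longrightarrow> cantor_denom P (n + 2) powr s \<le> cantor_denom m n"
    using ev unfolding eventually_sequentially by blast
  define h where "h n = cantor_denom P (n + 2) powr s / cantor_denom m n" for n
  \<comment> \<open>The constant absorbs the finitely many indices before \<open>ev\<close> takes
    effect.\<close>
  define K where "K = Max (insert 1 (h ` {..n0}))"
  have K: "1 \<le> K" by (simp add: K_def)
  have hK: "h n \<le> K" for n
  proof (cases "n \<le> n0")
    case True
    then show ?thesis unfolding K_def by (intro Max_ge) auto
  next
    case False
    then have "h n \<le> 1" using n0[of n] by (simp add: h_def)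
    then show ?thesis using K by simp
  qed
  have hK': "1 / cantor_denom m n \<le> K * (1 / cantor_denom P (n + 2)) powr s" for n
  proof -
    have D: "0 < cantor_denom P (n + 2) powr s" using P.denom_nonzero[of "n + 2"] by simp
    have "1 / cantor_denom m n = h n / cantor_denom P (n + 2) powr s"
      using D by (simp add: h_def)
    also have "\<dots> \<le> K / cantor_denom P (n + 2) powr s"
      by (intro divide_right_mono hK) simp
    finally show ?thesis by (simp add: powr_divide less_imp_le)
  qed
  define E where "E y n = m.floor_digits y n + a n" for y n
  define g where "g y = cantor_value P (E y)" for y
  have mem: "E y n \<in> {a n..<a n + m n}" if "1 \<le> n" for y n
    using m.floor_digits_range[OF that, of y] by (auto simp: E_def)
  have Eb: "\<bar>E y n\<bar> \<le> P n - 1" if "1 \<le> n" for y n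
    using mem[OF that, of y] a[OF that] am[OF that] by auto
  have fb: "\<bar>m.floor_digits y n\<bar> \<le> m n - 1" "\<bar>m.floor_digits y n - m.floor_digits y' n\<bar> \<le> m n - 1"
    if "1 \<le> n" for y y' n
    using m.floor_digits_range[OF that, of y] m.floor_digits_range[OF that, of y'] by auto
  have gap: "\<bar>y - y'\<bar> \<le> K * dist (g y) (g y') powr s"
    if y: "y \<in> {0..<1}" "y' \<in> {0..<1}" and k: "m.floor_digits y (Suc k) < m.floor_digits y' (Suc k)"
      and z: "\<And>i. 1 \<le> i \<Longrightarrow> i \<le> k \<Longrightarrow> m.floor_digits y i = m.floor_digits y' i" for y y' k
  proof -
    let ?f = "\<lambda>i. m.floor_digits y i - m.floor_digits y' i"
    have "y - y' = cantor_value m ?f"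
      using m.cantor_value_diff[of "m.floor_digits y" "m.floor_digits y'"] fb(1)
        m.value_floor_digits y by simp
    then have 1: "\<bar>y - y'\<bar> \<le> 1 / cantor_denom m k"
      using m.value_le_of_agree[of ?f k] fb(2) z by simp
    \<comment> \<open>Since \<open>m n \<le> P n - 1\<close> at every place, the place right after
      the first difference already has a digit difference of at most \<open>P (k + 2) - 2\<close>
      and provides the gap.\<close>
    have "cantor_value P (\<lambda>i. E y i - E y' i) \<le> - (1 / cantor_denom P (k + 2))"
    proof (rule P.value_le_neg[of _ k])
      show "\<bar>E y n - E y' n\<bar> \<le> P n - 1" if "1 \<le> n" for n
        using fb(2)[OF that, of y y'] mP[OF that] by (simp add: E_def)
      show "E y (k + 2) - E y' (k + 2) \<le> P (k + 2) - 2"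
        using fb(2)[of "k + 2" y y'] mP[of "k + 2"] by (simp add: E_def)
    qed (use k z in \<open>auto simp: E_def\<close>)
    then have "1 / cantor_denom P (k + 2) \<le> dist (g y) (g y')"
      using P.cantor_value_diff[of "E y" "E y'"] Eb by (simp add: g_def dist_real_def)
    then have "(1 / cantor_denom P (k + 2)) powr s \<le> dist (g y) (g y') powr s"
      using s by (intro powr_mono2) (auto simp: less_imp_le)
    then have "K * (1 / cantor_denom P (k + 2)) powr s \<le> K * dist (g y) (g y') powr s"
      using K by (intro mult_left_mono) auto
    with 1 hK'[of k] show ?thesis by linarith
  qed
  show ?thesis
  proof (rule hausdorff_measure_nonzeroI[where g = g and C = K])
    show "g ` {0..<1} \<subseteq> digit_set P a m"
      using mem by (auto simp: g_def digit_set_def)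
    fix y y' :: real assume y: "y \<in> {0..<1}" "y' \<in> {0..<1}" "y \<noteq> y'"
    let ?ne = "\<lambda>k. m.floor_digits y (Suc k) \<noteq> m.floor_digits y' (Suc k)"
    have "\<exists>k. ?ne k"
    proof (rule ccontr)
      assume "\<not> ?thesis"
      then have "cantor_value m (m.floor_digits y) = cantor_value m (m.floor_digits y')"
        unfolding cantor_value_def by simp
      then show False using y m.value_floor_digits by metis
    qed
    then have k: "?ne (LEAST k. ?ne k)" by (rule LeastI_ex)
    define k where "k = (LEAST k. ?ne k)"
    have z: "m.floor_digits y i = m.floor_digits y' i" if "1 \<le> i" "i \<le> k" for i
      using not_less_Least[of "i - 1" ?ne] that by (auto simp: k_def)
    show "\<bar>y - y'\<bar> \<le> K * dist (g y) (g y') powr s"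
    proof (cases "m.floor_digits y (Suc k) < m.floor_digits y' (Suc k)")
      case True
      then show ?thesis using y z by (intro gap) auto
    next
      case False
      then have "m.floor_digits y' (Suc k) < m.floor_digits y (Suc k)"
        using k[folded k_def] by simp
      then have "\<bar>y' - y\<bar> \<le> K * dist (g y') (g y) powr s"
        using y z by (intro gap[of y' y k]) auto
      then show ?thesis by (simp only: dist_commute abs_minus_commute)
    qed
  qed (use s K in auto)
qed

proposition digit_set_dim:
  assumes P: "cantor_base P"
    and m: "\<And>n. 1 \<le> n \<Longrightarrow> 1 \<le> m n" and a: "\<And>n. 1 \<le> n \<Longrightarrow> 0 \<le> a n"
    and am: "\<And>n. 1 \<le> n \<Longrightarrow> a n + m n \<le> P n" and mP: "\<And>n. 1 \<le> n \<Longrightarrow> m n \<le> P n - 1"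
    and v: "(\<lambda>n. ln (cantor_denom m n) / ln (cantor_denom P n)) \<longlonglongrightarrow> v" "0 \<le> v"
    and slow: "(\<lambda>n. ln (real_of_int (P n)) / ln (cantor_denom P n)) \<longlonglongrightarrow> 0"
  shows "hausdorff_dim (digit_set P a m) = ereal v"
proof (rule antisym)
  interpret cantor_base P by (rule P)
  show "hausdorff_dim (digit_set P a m) \<le> ereal v"
  proof (rule ereal_le_epsilon2)
    fix e :: real assume "0 < e"
    then have "hausdorff_measure (v + e) (digit_set P a m) = 0"
      using v(2) by (intro digit_set_measure_zero[OF P m a am v(1)]) auto
    then show "hausdorff_dim (digit_set P a m) \<le> ereal v + ereal e"
      unfolding hausdorff_dim_def using v(2) \<open>0 < e\<close> by (intro Inf_lower) auto
  qed
  have m_pos: "0 < cantor_denom m n" for n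
    unfolding cantor_denom_def using m by (force intro!: prod_pos)
  have gt1: "\<forall>\<^sub>F n in sequentially. 1 < cantor_denom P n"
    using denom_at_top unfolding filterlim_at_top_dense by blast
  \<comment> \<open>By \<open>slow\<close>, consecutive values of ln D_n are asymptotically equal,
    so the index shift by two in the Hoelder estimate does not change the limiting exponent.\<close>
  have ratio: "(\<lambda>n. ln (cantor_denom P n) / ln (cantor_denom P (Suc n))) \<longlonglongrightarrow> 1"
  proof (rule Lim_transform_eventually)
    show "(\<lambda>n. 1 - ln (real_of_int (P (Suc n))) / ln (cantor_denom P (Suc n))) \<longlonglongrightarrow> 1"
      using tendsto_diff[OF tendsto_const[of 1] LIMSEQ_Suc[OF slow]] by simp
    show "\<forall>\<^sub>F n in sequentially. 1 - ln (real_of_int (P (Suc n))) / ln (cantor_denom P (Suc n))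
        = ln (cantor_denom P n) / ln (cantor_denom P (Suc n))"
      using eventually_compose_filterlim[OF gt1 filterlim_Suc]
    proof eventually_elim
      case (elim n)
      have "ln (cantor_denom P (Suc n)) = ln (cantor_denom P n) + ln (real_of_int (P (Suc n)))"
        using base_ge_1[of "Suc n"] by (simp add: cantor_denom_Suc ln_mult)
      moreover have "0 < ln (cantor_denom P (Suc n))" using elim by simp
      ultimately show ?case by (simp add: field_simps)
    qed
  qed
  have pos_measure: "hausdorff_measure s (digit_set P a m) \<noteq> 0" if s: "0 \<le> s" "s < v" for s
  proof -
    have gt1': "\<forall>\<^sub>F n in sequentially. \<forall>i\<in>{0, 1, 2}. 1 < cantor_denom P (n + i)"
      using gt1 unfolding eventually_sequentially by (meson order_trans le_add1)
    \<comment> \<open>The three ratios telescope to ln M_n / ln D_(n+2).\<close>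
    have "(\<lambda>n. ln (cantor_denom m n) / ln (cantor_denom P n) *
        (ln (cantor_denom P n) / ln (cantor_denom P (Suc n)) *
         (ln (cantor_denom P (Suc n)) / ln (cantor_denom P (Suc (Suc n)))))) \<longlonglongrightarrow> v * (1 * 1)"
      by (intro tendsto_mult v ratio LIMSEQ_Suc[OF ratio])
    then have "\<forall>\<^sub>F n in sequentially. s < ln (cantor_denom m n) / ln (cantor_denom P n) *
        (ln (cantor_denom P n) / ln (cantor_denom P (Suc n)) *
         (ln (cantor_denom P (Suc n)) / ln (cantor_denom P (Suc (Suc n)))))"
      using s by (intro order_tendstoD(1)) auto
    then have ev: "\<forall>\<^sub>F n in sequentially. cantor_denom P (n + 2) powr s \<le> cantor_denom m n"
      using gt1'
    proof eventually_elim
      case (elim n)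
      then have "s < ln (cantor_denom m n) / ln (cantor_denom P (n + 2))"
        by (simp add: field_simps)
      then have "s * ln (cantor_denom P (n + 2)) \<le> ln (cantor_denom m n)"
        using elim(2) by (simp add: pos_less_divide_eq)
      then have "exp (s * ln (cantor_denom P (n + 2))) \<le> exp (ln (cantor_denom m n))"
        by simp
      then show ?case using elim(2) m_pos[of n] by (simp add: powr_def)
    qed
    \<comment> \<open>Here \<open>v\<close> is positive because \<open>0 \<le> s\<close> and
      \<open>s < v\<close>. Hence ln M_n, which is about \<open>v\<close> times ln D_n, tends to
      infinity.\<close>
    have "cantor_base m"
    proof
      let ?h = "\<lambda>n. ln (cantor_denom m n) / ln (cantor_denom P n) * ln (cantor_denom P n)"
      have "filterlim ?h at_top sequentially"
        using s by (intro filterlim_tendsto_pos_mult_at_top[OF v(1)]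
          filterlim_compose[OF ln_at_top denom_at_top]) simp
      then have "filterlim (\<lambda>n. exp (?h n)) at_top sequentially"
        by (rule filterlim_compose[OF exp_at_top])
      moreover have "\<forall>\<^sub>F n in sequentially. exp (?h n) = cantor_denom m n"
        using gt1 by eventually_elim (simp add: m_pos)
      note filterlim_cong[OF refl refl this, THEN iffD1]
      ultimately show "filterlim (cantor_denom m) at_top sequentially" by simp
    qed (use m in auto)
    then show ?thesis
      by (rule digit_set_measure_nonzero[OF P _ a am mP ev s(1)])
  qed
  show "ereal v \<le> hausdorff_dim (digit_set P a m)"
    unfolding hausdorff_dim_def
  proof (rule Inf_greatest)
    fix z assume "z \<in> {ereal s |s. 0 \<le> s \<and> hausdorff_measure s (digit_set P a m) = 0}"
    then obtain s where s: "z = ereal s" "0 \<le> s" "hausdorff_measure s (digit_set P a m) = 0"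
      by blast
    then have "v \<le> s" using pos_measure[of s] by (meson not_le)
    then show "ereal v \<le> z" by (simp add: s(1))
  qed
qed

section \<open>Averages along sequences that grow nicely\<close>

text \<open>Beyond some \<open>N1\<close> each term is at most \<open>e / 2 * a n\<close> in
  absolute value; the earlier terms add up to a constant, negligible against the divergent sum of
  weights.\<close>

lemma weighted_average_null:
  fixes a c :: "nat \<Rightarrow> real"
  assumes pos: "\<And>n. 1 \<le> n \<Longrightarrow> 0 < a n"
    and A: "filterlim (\<lambda>N. \<Sum>n=1..N. a n) at_top sequentially"
    and c: "(\<lambda>n. c n / a n) \<longlonglongrightarrow> 0"
  shows "(\<lambda>N. (\<Sum>n=1..N. c n) / (\<Sum>n=1..N. a n)) \<longlonglongrightarrow> 0"
proof (rule LIMSEQ_I)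
  fix e :: real assume e: "0 < e"
  obtain N1 where N1: "\<And>n. N1 \<le> n \<Longrightarrow> \<bar>c n / a n\<bar> < e / 2"
    using LIMSEQ_D[OF c, of "e / 2"] e by auto
  define C where "C = (\<Sum>n<Suc N1. \<bar>c n\<bar>)"
  have bound: "\<bar>c n\<bar> \<le> e / 2 * a n + (if n \<le> N1 then \<bar>c n\<bar> else 0)" if "1 \<le> n" for n
    using N1[of n] pos[OF that] e by (auto simp: abs_divide pos_divide_less_eq less_imp_le)
  have sum: "\<bar>\<Sum>n=1..N. c n\<bar> \<le> e / 2 * (\<Sum>n=1..N. a n) + C" for N
  proof -
    have "\<bar>\<Sum>n=1..N. c n\<bar> \<le> (\<Sum>n=1..N. \<bar>c n\<bar>)" by (rule sum_abs)
    also have "\<dots> \<le> (\<Sum>n=1..N. e / 2 * a n + (if n \<le> N1 then \<bar>c n\<bar> else 0))"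
      by (intro sum_mono bound) auto
    also have "\<dots> = e / 2 * (\<Sum>n=1..N. a n) + (\<Sum>n=1..N. if n \<le> N1 then \<bar>c n\<bar> else 0)"
      by (simp add: sum.distrib sum_distrib_left)
    also have "(\<Sum>n=1..N. if n \<le> N1 then \<bar>c n\<bar> else 0) = (\<Sum>n\<in>{1..N} \<inter> {..N1}. \<bar>c n\<bar>)"
      by (subst sum.inter_restrict) auto
    also have "\<dots> \<le> C"
      unfolding C_def by (rule sum_mono2) auto
    finally show ?thesis by simp
  qed
  have "\<forall>\<^sub>F N in sequentially. max 0 (2 * C / e) < (\<Sum>n=1..N. a n)"
    using A unfolding filterlim_at_top_dense by blast
  then obtain N2 where N2: "\<And>N. N2 \<le> N \<Longrightarrow> max 0 (2 * C / e) < (\<Sum>n=1..N. a n)"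
    unfolding eventually_sequentially by blast
  show "\<exists>no. \<forall>N\<ge>no. norm ((\<Sum>n=1..N. c n) / (\<Sum>n=1..N. a n) - 0) < e"
  proof (intro exI allI impI)
    fix N assume N: "N2 \<le> N"
    have A0: "0 < (\<Sum>n=1..N. a n)" and "2 * C / e < (\<Sum>n=1..N. a n)" using N2[OF N] by auto
    then have "C < e / 2 * (\<Sum>n=1..N. a n)" using e by (simp add: field_simps)
    then have "\<bar>\<Sum>n=1..N. c n\<bar> < e * (\<Sum>n=1..N. a n)" using sum[of N] by simp
    then show "norm ((\<Sum>n=1..N. c n) / (\<Sum>n=1..N. a n) - 0) < e"
      using A0 by (simp add: abs_divide pos_divide_less_eq)
  qed
qed

text \<open>Against monotone weights, bounded partial sums leave at most a constant plus twice the
  size of the last weight, which \<open>small\<close> makes negligible. The constant collects what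
  happens up to \<open>N0\<close>.\<close>

lemma bounded_sum_average_null:
  fixes a :: "nat \<Rightarrow> real" and \<epsilon> :: "nat \<Rightarrow> real"
  assumes A: "filterlim (\<lambda>N. \<Sum>n=1..N. a n) at_top sequentially"
    and mono: "mono_on {N0..} a"
    and small: "(\<lambda>N. a N / (\<Sum>n=1..N. a n)) \<longlonglongrightarrow> 0"
    and bounded: "\<And>N. \<bar>\<Sum>n=1..N. \<epsilon> n\<bar> \<le> 1"
  shows "(\<lambda>N. (\<Sum>n=1..N. \<epsilon> n * a n) / (\<Sum>n=1..N. a n)) \<longlonglongrightarrow> 0"
proof -
  define s where "s N = (\<Sum>n=1..N. \<epsilon> n)" for N
  \<comment> \<open>Abel summation: \<open>T (Suc N) - T N = - s N * (a (Suc N) - a N)\<close>.\<close>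
  define T where "T N = (\<Sum>n=1..N. \<epsilon> n * a n) - s N * a N" for N
  define C where "C = \<bar>T N0\<bar> + \<bar>a N0\<bar>"
  have T: "\<bar>T N\<bar> \<le> C + a N" if "N0 \<le> N" for N
  proof -
    have "\<bar>T N\<bar> \<le> \<bar>T N0\<bar> + (a N - a N0)"
      using that
    proof (induction rule: dec_induct)
      case (step N)
      have le: "a N \<le> a (Suc N)" using mono step.hyps by (auto simp: mono_on_def)
      have "T (Suc N) = T N - s N * (a (Suc N) - a N)"
        by (simp add: T_def s_def algebra_simps)
      moreover have "\<bar>s N * (a (Suc N) - a N)\<bar> \<le> 1 * (a (Suc N) - a N)"
        unfolding abs_mult using bounded[of N] le by (intro mult_mono) (auto simp: s_def)
      ultimately show ?case
        using step.IH abs_triangle_ineq4[of "T N" "s N * (a (Suc N) - a N)"] by simp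
    qed simp
    then show ?thesis by (simp add: C_def)
  qed
  show ?thesis
  proof (rule Lim_null_comparison)
    have "(\<lambda>N. C * (1 / (\<Sum>n=1..N. a n)) + (a N / (\<Sum>n=1..N. a n) + \<bar>a N / (\<Sum>n=1..N. a n)\<bar>)) \<longlonglongrightarrow> C * 0 + (0 + \<bar>0\<bar>)"
      using tendsto_inverse_0_at_top[OF A]
      by (intro tendsto_add tendsto_mult tendsto_const small tendsto_rabs) (simp add: inverse_eq_divide)
    then show "(\<lambda>N. C * (1 / (\<Sum>n=1..N. a n)) + (a N / (\<Sum>n=1..N. a n) + \<bar>a N / (\<Sum>n=1..N. a n)\<bar>)) \<longlonglongrightarrow> 0"
      by simp
    have "\<forall>\<^sub>F N in sequentially. 0 < (\<Sum>n=1..N. a n)"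
      using A unfolding filterlim_at_top_dense by blast
    then show "\<forall>\<^sub>F N in sequentially. norm ((\<Sum>n=1..N. \<epsilon> n * a n) / (\<Sum>n=1..N. a n))
        \<le> C * (1 / (\<Sum>n=1..N. a n)) + (a N / (\<Sum>n=1..N. a n) + \<bar>a N / (\<Sum>n=1..N. a n)\<bar>)"
      using eventually_ge_at_top[of N0]
    proof eventually_elim
      case (elim N)
      have "\<bar>s N * a N\<bar> \<le> 1 * \<bar>a N\<bar>"
        unfolding abs_mult using bounded[of N] by (intro mult_right_mono) (auto simp: s_def)
      moreover have "(\<Sum>n=1..N. \<epsilon> n * a n) = T N + s N * a N" by (simp add: T_def)
      ultimately have "\<bar>\<Sum>n=1..N. \<epsilon> n * a n\<bar> \<le> C + a N + \<bar>a N\<bar>"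
        using T[OF elim(2)] by linarith
      then have "\<bar>\<Sum>n=1..N. \<epsilon> n * a n\<bar> / (\<Sum>n=1..N. a n) \<le> (C + a N + \<bar>a N\<bar>) / (\<Sum>n=1..N. a n)"
        using elim(1) by (intro divide_right_mono) auto
      then show ?case using elim(1) by (simp add: abs_divide add_divide_distrib)
    qed
  qed
qed

text \<open>Split \<open>u n * b n\<close> into \<open>u n * (b n - L * a n)\<close>,
  \<open>L * (u n - \<delta>) * a n\<close> and \<open>\<delta> * L * a n\<close>. The first is
  termwise small relative to \<open>a n\<close>, in the second \<open>u n - \<delta>\<close> has
  bounded partial sums, and the third gives the limit.\<close>

lemma selected_average_tendsto:
  fixes a b u :: "nat \<Rightarrow> real"
  assumes pos: "\<And>n. 1 \<le> n \<Longrightarrow> 0 < a n"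
    and A: "filterlim (\<lambda>N. \<Sum>n=1..N. a n) at_top sequentially"
    and mono: "mono_on {N0..} a"
    and small: "(\<lambda>N. a N / (\<Sum>n=1..N. a n)) \<longlonglongrightarrow> 0"
    and u: "\<And>n. \<bar>u n\<bar> \<le> 1" and density: "\<And>N. \<bar>(\<Sum>n=1..N. u n) - \<delta> * real N\<bar> \<le> 1"
    and b: "(\<lambda>n. b n / a n) \<longlonglongrightarrow> L"
  shows "(\<lambda>N. (\<Sum>n=1..N. u n * b n) / (\<Sum>n=1..N. a n)) \<longlonglongrightarrow> \<delta> * L"
proof -
  have "(\<lambda>n. u n * (b n - L * a n) / a n) \<longlonglongrightarrow> 0"
  proof (rule Lim_null_comparison)
    show "(\<lambda>n. \<bar>b n / a n - L\<bar>) \<longlonglongrightarrow> 0"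
      using tendsto_rabs[OF tendsto_diff[OF b tendsto_const[of L]]] by simp
    show "\<forall>\<^sub>F n in sequentially. norm (u n * (b n - L * a n) / a n) \<le> \<bar>b n / a n - L\<bar>"
      using eventually_ge_at_top[of 1]
    proof eventually_elim
      case (elim n)
      have "u n * (b n - L * a n) / a n = u n * (b n / a n - L)"
        using pos[OF elim] by (simp add: field_simps)
      then show ?case
        using mult_right_mono[OF u[of n], of "\<bar>b n / a n - L\<bar>"] by (simp add: abs_mult)
    qed
  qed
  from weighted_average_null[OF pos A this]
  have 1: "(\<lambda>N. (\<Sum>n=1..N. u n * (b n - L * a n)) / (\<Sum>n=1..N. a n)) \<longlonglongrightarrow> 0" .
  have "\<bar>\<Sum>n=1..N. u n - \<delta>\<bar> \<le> 1" for N
    using density[of N] by (simp add: sum_subtractf mult.commute)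
  from bounded_sum_average_null[OF A mono small this]
  have 2: "(\<lambda>N. (\<Sum>n=1..N. (u n - \<delta>) * a n) / (\<Sum>n=1..N. a n)) \<longlonglongrightarrow> 0" .
  have "(\<lambda>N. (\<Sum>n=1..N. u n * (b n - L * a n)) / (\<Sum>n=1..N. a n)
      + L * ((\<Sum>n=1..N. (u n - \<delta>) * a n) / (\<Sum>n=1..N. a n)) + \<delta> * L) \<longlonglongrightarrow> 0 + L * 0 + \<delta> * L"
    by (intro tendsto_add tendsto_mult tendsto_const 1 2)
  then have "(\<lambda>N. (\<Sum>n=1..N. u n * (b n - L * a n)) / (\<Sum>n=1..N. a n)
      + L * ((\<Sum>n=1..N. (u n - \<delta>) * a n) / (\<Sum>n=1..N. a n)) + \<delta> * L) \<longlonglongrightarrow> \<delta> * L"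
    by simp
  then show ?thesis
  proof (rule Lim_transform_eventually)
    have "\<forall>\<^sub>F N in sequentially. 0 < (\<Sum>n=1..N. a n)"
      using A unfolding filterlim_at_top_dense by blast
    then show "\<forall>\<^sub>F N in sequentially. (\<Sum>n=1..N. u n * (b n - L * a n)) / (\<Sum>n=1..N. a n)
        + L * ((\<Sum>n=1..N. (u n - \<delta>) * a n) / (\<Sum>n=1..N. a n)) + \<delta> * L
        = (\<Sum>n=1..N. u n * b n) / (\<Sum>n=1..N. a n)"
    proof eventually_elim
      case (elim N)
      have "(\<Sum>n=1..N. u n * b n) = (\<Sum>n=1..N. u n * (b n - L * a n))
          + L * (\<Sum>n=1..N. (u n - \<delta>) * a n) + \<delta> * L * (\<Sum>n=1..N. a n)"
        unfolding sum_distrib_left sum.distrib[symmetric]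
        by (rule sum.cong) (auto simp: algebra_simps)
      then show ?case using elim by (simp add: add_divide_distrib)
    qed
  qed
qed

section \<open>Triangular blocks and the size of the last logarithm\<close>

lemma triangular_Suc: "triangular (Suc n) = triangular n + Suc n"
proof -
  have "Suc n * (Suc n + 1) = n * (n + 1) + Suc n * 2" by simp
  then show ?thesis unfolding triangular_def by (metis div_mult_self1 zero_neq_numeral add.commute)
qed

lemma le_triangular: "n \<le> triangular n"
  by (induction n) (auto simp: triangular_Suc)

lemma between_triangular:
  assumes "triangular k \<le> N"
  shows "\<exists>j\<ge>k. triangular j \<le> N \<and> N < triangular (Suc j)"
  using assms
proof (induction rule: dec_induct)
  case base
  then show ?case by (intro exI[of _ k]) (simp add: triangular_Suc)
next
  case (step N)
  then obtain j where j: "k \<le> j" "triangular j \<le> N" "N < triangular (Suc j)" by blast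
  show ?case
  proof (cases "Suc N < triangular (Suc j)")
    case True
    then show ?thesis using j by (intro exI[of _ j]) auto
  next
    case False
    then show ?thesis using j by (intro exI[of _ "Suc j"]) (auto simp: triangular_Suc)
  qed
qed

text \<open>Let N lie between the triangular numbers of index j + 1 and j + 2. The ratio condition
  bounds ln s_N by twice the logarithm at index j, while the full block from index j to j + 1 lies
  below N and has j + 1 terms at least that large. The quotient is thus at most 2 / (j + 1).\<close>

lemma grows_nicely_ln_small:
  assumes s: "grows_nicely s" and ge: "\<And>n. 1 \<le> n \<Longrightarrow> 2 \<le> s n"
  shows "(\<lambda>N. ln (s N) / (\<Sum>n=1..N. ln (s n))) \<longlonglongrightarrow> 0"
proof (rule LIMSEQ_I)
  fix e :: real assume e: "0 < e"
  obtain N0 where N0: "mono_on {N0..} s" using s unfolding grows_nicely_def by blast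
  define a where "a n = ln (s n)" for n
  have a_pos: "0 < a n" if "1 \<le> n" for n using ge[OF that] by (simp add: a_def)
  have a_mono: "a n \<le> a n'" if "max 1 N0 \<le> n" "n \<le> n'" for n n'
    using mono_onD[OF N0, of n n'] ge[of n] ge[of n'] that by (simp add: a_def)
  have "(\<lambda>n. a (triangular (n + 2)) / a (triangular n)) \<longlonglongrightarrow> 1"
    using s by (simp add: grows_nicely_def a_def)
  then have "\<forall>\<^sub>F n in sequentially. a (triangular (n + 2)) / a (triangular n) < 2"
    by (rule order_tendstoD) simp
  then obtain K where K: "\<And>n. K \<le> n \<Longrightarrow> a (triangular (n + 2)) / a (triangular n) < 2"
    unfolding eventually_sequentially by blast
  \<comment> \<open>Any j \<ge> \<open>M\<close> brings the bound 2 / (j + 1) below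
    \<open>e\<close>.\<close>
  obtain M :: nat where M: "2 / e < real M" using reals_Archimedean2 by blast
  define J where "J = max (max K M) (max 1 N0)"
  have "norm (a N / (\<Sum>n=1..N. a n) - 0) < e" if N: "triangular (Suc J) \<le> N" for N
  proof -
    obtain j' where j': "Suc J \<le> j'" "triangular j' \<le> N" "N < triangular (Suc j')"
      using between_triangular[OF N] by blast
    then obtain j where j: "j' = Suc j" "J \<le> j" by (cases j') auto
    have jt: "max 1 N0 \<le> triangular j" using le_triangular[of j] j by (auto simp: J_def)
    have tj: "0 < a (triangular j)" using a_pos jt by simp
    have "a N \<le> a (triangular (j + 2))"
      using j' j jt by (intro a_mono) (auto simp: triangular_Suc)
    also have "\<dots> \<le> 2 * a (triangular j)"
      using K[of j] j tj by (simp add: J_def pos_divide_less_eq less_imp_le)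
    finally have aN: "a N \<le> 2 * a (triangular j)" .
    have "real (Suc j) * a (triangular j) = (\<Sum>n\<in>{triangular j<..triangular (Suc j)}. a (triangular j))"
      by (simp add: triangular_Suc)
    also have "\<dots> \<le> (\<Sum>n\<in>{triangular j<..triangular (Suc j)}. a n)"
      using jt by (intro sum_mono a_mono) auto
    also have "\<dots> \<le> (\<Sum>n=1..N. a n)"
      using j' j a_pos by (intro sum_mono2) (auto simp: less_imp_le)
    finally have A: "real (Suc j) * a (triangular j) \<le> (\<Sum>n=1..N. a n)" .
    have Npos: "1 \<le> N" using jt j' j by (simp add: triangular_Suc)
    have Apos: "0 < (\<Sum>n=1..N. a n)"
      using A tj by (smt (verit) mult_pos_pos of_nat_0_less_iff zero_less_Suc)
    have "2 < e * real (Suc j)"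
    proof -
      have "2 < e * real M" using M e by (simp add: pos_divide_less_eq mult.commute)
      also have "\<dots> \<le> e * real (Suc j)" using e j by (intro mult_left_mono) (auto simp: J_def)
      finally show ?thesis .
    qed
    then have "2 * a (triangular j) < e * real (Suc j) * a (triangular j)"
      using tj by (intro mult_strict_right_mono)
    also have "\<dots> \<le> e * (\<Sum>n=1..N. a n)"
      unfolding mult.assoc using A e by (intro mult_left_mono) auto
    finally have "a N < e * (\<Sum>n=1..N. a n)" using aN by linarith
    then show ?thesis using Apos a_pos[OF Npos] by (simp add: abs_divide pos_divide_less_eq)
  qed
  then show "\<exists>no. \<forall>N\<ge>no. norm (ln (s N) / (\<Sum>n=1..N. ln (s n)) - 0) < e"
    unfolding a_def by blast
qed

section \<open>Logarithms of products of bases\<close>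

lemma ln_cantor_denom:
  assumes "\<And>n. 1 \<le> n \<Longrightarrow> 1 \<le> P n"
  shows "ln (cantor_denom P n) = (\<Sum>k=1..n. ln (real_of_int (P k)))"
proof -
  have "\<And>k. k \<in> {1..n} \<Longrightarrow> real_of_int (P k) \<noteq> 0" using assms by force
  then show ?thesis unfolding cantor_denom_def of_int_prod by (intro ln_prod) auto
qed

lemma ln_cantor_denom_at_top:
  assumes "basic_sequence P"
  shows "filterlim (\<lambda>N. \<Sum>n=1..N. ln (real_of_int (P n))) at_top sequentially"
proof -
  interpret cantor_base P by (rule cantor_base_basic[OF assms])
  show ?thesis
    using filterlim_compose[OF ln_at_top denom_at_top] ln_cantor_denom[of P] base_ge_1 by simp
qed

lemma grows_nicely_denom_small:
  assumes P: "basic_sequence P" "grows_nicely (\<lambda>n. real_of_int (P n))"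
  shows "(\<lambda>n. ln (real_of_int (P n)) / ln (cantor_denom P n)) \<longlonglongrightarrow> 0"
proof -
  have "2 \<le> real_of_int (P n)" if "1 \<le> n" for n
    using P(1) that by (force simp: basic_sequence_def)
  from grows_nicely_ln_small[OF P(2) this]
  show ?thesis
    using cantor_base.base_ge_1[OF cantor_base_basic[OF P(1)]] by (simp add: ln_cantor_denom)
qed

text \<open>Intended for \<open>u\<close> the indicator of the places with a free digit and
  \<open>b\<close> the logarithm of the number of choices there; at other places
  \<open>m n = 1\<close> contributes 0. Density \<delta> and relative logarithmic size
  \<open>L\<close> multiply.\<close>

lemma selected_denom_ratio:
  fixes u b :: "nat \<Rightarrow> real"
  assumes P: "basic_sequence P" "grows_nicely (\<lambda>n. real_of_int (P n))"
    and m: "\<And>n. 1 \<le> n \<Longrightarrow> 1 \<le> m n" "\<And>n. 1 \<le> n \<Longrightarrow> ln (real_of_int (m n)) = u n * b n"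
    and u: "\<And>n. \<bar>u n\<bar> \<le> 1" "\<And>N. \<bar>(\<Sum>n=1..N. u n) - \<delta> * real N\<bar> \<le> 1"
    and b: "(\<lambda>n. b n / ln (real_of_int (P n))) \<longlonglongrightarrow> L"
  shows "(\<lambda>n. ln (cantor_denom m n) / ln (cantor_denom P n)) \<longlonglongrightarrow> \<delta> * L"
proof -
  have ge: "2 \<le> real_of_int (P n)" if "1 \<le> n" for n
    using P(1) that by (force simp: basic_sequence_def)
  obtain N0 where N0: "mono_on {N0..} (\<lambda>n. real_of_int (P n))"
    using P(2) unfolding grows_nicely_def by blast
  have mono: "mono_on {max 1 N0..} (\<lambda>n. ln (real_of_int (P n)))"
  proof (rule mono_onI)
    fix n n' assume "n \<in> {max 1 N0..}" "n' \<in> {max 1 N0..}" "n \<le> n'"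
    then show "ln (real_of_int (P n)) \<le> ln (real_of_int (P n'))"
      using mono_onD[OF N0, of n n'] ge[of n] ge[of n'] by simp
  qed
  have pos: "0 < ln (real_of_int (P n))" if "1 \<le> n" for n
    using ge[OF that] by simp
  have "(\<lambda>N. (\<Sum>n=1..N. u n * b n) / (\<Sum>n=1..N. ln (real_of_int (P n)))) \<longlonglongrightarrow> \<delta> * L"
    by (rule selected_average_tendsto[OF pos ln_cantor_denom_at_top[OF P(1)] mono
        grows_nicely_ln_small[OF P(2) ge] u b])
  moreover have "ln (cantor_denom m N) = (\<Sum>n=1..N. u n * b n)" for N
    using ln_cantor_denom[of m N] m by simp
  moreover have "ln (cantor_denom P N) = (\<Sum>n=1..N. ln (real_of_int (P n)))" for N
    using ln_cantor_denom[of P N] cantor_base.base_ge_1[OF cantor_base_basic[OF P(1)]] by simp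
  ultimately show ?thesis by simp
qed

section \<open>Level sets\<close>

lemma cantor_digits_value:
  assumes P: "basic_sequence P" and E: "\<And>n. 1 \<le> n \<Longrightarrow> E n \<in> {0..P n - 1}"
    and E0: "\<exists>\<^sub>\<infinity>n. E n \<noteq> 0" and E1: "\<exists>\<^sub>\<infinity>n. E n \<noteq> P n - 1"
    and n: "1 \<le> n"
  shows "cantor_digits P (cantor_value P E) n = E n"
proof -
  interpret cantor_base P by (rule cantor_base_basic[OF P])
  define x where "x = cantor_value P E"
  have x: "0 < x" "x < 1" using value_bounds[of E] E E0 E1 by (auto simp: x_def)
  have "\<bar>E i\<bar> \<le> P i - 1" if "1 \<le> i" for i using E[OF that] by auto
  then have "(\<lambda>n. real_of_int (E (Suc n)) / cantor_denom P (Suc n)) sums x"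
    unfolding x_def cantor_value_def by (intro summable_sums summable_digits) auto
  \<comment> \<open>Place 0 of an expansion stores the integer part, here 0, whereas
    \<open>E 0\<close> is arbitrary.\<close>
  moreover have "\<exists>\<^sub>\<infinity>n. (E(0 := 0)) n \<noteq> P n - 1"
    using E1 unfolding INFM_nat by (metis fun_upd_other less_nat_zero_code)
  moreover have "\<lfloor>x\<rfloor> = 0" using x by (simp add: floor_eq_iff)
  ultimately have "cantor_expansion P x (E(0 := 0))"
    unfolding cantor_expansion_def cantor_denom_def using E by simp
  then have "cantor_digits P x = E(0 := 0)"
    using ex1_cantor_expansion[OF P] cantor_expansion_digits[OF P] by blast
  then show ?thesis using n by (simp add: x_def)
qed

lemma cantor_digits_in_unit:
  assumes P: "basic_sequence P" and x: "x \<in> {0<..<1}"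
  shows "1 \<le> n \<Longrightarrow> cantor_digits P x n \<in> {0..P n - 1}"
    and "cantor_value P (cantor_digits P x) = x"
proof -
  have exp: "cantor_expansion P x (cantor_digits P x)" by (rule cantor_expansion_digits[OF P])
  then show "1 \<le> n \<Longrightarrow> cantor_digits P x n \<in> {0..P n - 1}"
    by (auto simp: cantor_expansion_def)
  have "\<lfloor>x\<rfloor> = 0" using x by (simp add: floor_eq_iff)
  with exp show "cantor_value P (cantor_digits P x) = x"
    unfolding cantor_expansion_def cantor_value_def cantor_denom_def by (auto simp: sums_iff)
qed

lemma psi_eq_cantor_value: "psi P Q x = cantor_value Q (\<lambda>n. min (cantor_digits P x n) (Q n - 1))"
  unfolding psi_def cantor_value_def cantor_denom_def ..

text \<open>Truncation at \<open>Q n - 1\<close> must return \<open>F n\<close>: below that value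
  the digit is forced, at it \<open>P n - Q n + 1\<close> digits remain. The two recurrence
  conditions make \<open>F\<close> the only possible truncated sequence, and they pass from
  \<open>F\<close> to \<open>E\<close>, so that \<open>E\<close> is the genuine expansion of its
  value.\<close>

lemma level_set_eq_digit_set:
  assumes P: "basic_sequence P" and Q: "basic_sequence Q" and less: "\<And>n. 1 \<le> n \<Longrightarrow> Q n < P n"
    and F: "\<And>n. 1 \<le> n \<Longrightarrow> F n \<in> {0..Q n - 1}"
    and F0: "\<exists>\<^sub>\<infinity>n. F n \<noteq> 0" and F1: "\<exists>\<^sub>\<infinity>n. F n \<noteq> Q n - 1"
  shows "level_set P Q (cantor_value Q F)
    = digit_set P F (\<lambda>n. if F n = Q n - 1 then P n - Q n + 1 else 1)"
proof (intro equalityI subsetI)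
  interpret Q: cantor_base Q by (rule cantor_base_basic[OF Q])
  fix x assume "x \<in> level_set P Q (cantor_value Q F)"
  then have x: "x \<in> {0<..<1}" and w: "psi P Q x = cantor_value Q F"
    by (auto simp: level_set_def)
  note dig = cantor_digits_in_unit[OF P x]
  have eq: "F n = min (cantor_digits P x n) (Q n - 1)" if n: "1 \<le> n" for n
  proof (rule Q.value_unique[OF _ _ F0 F1 _ n])
    show "cantor_value Q F = cantor_value Q (\<lambda>n. min (cantor_digits P x n) (Q n - 1))"
      using w by (simp add: psi_eq_cantor_value)
  qed (use F dig Q.base_ge_1 in \<open>force simp: min_def\<close>)+
  have "cantor_digits P x n \<in> {F n..<F n + (if F n = Q n - 1 then P n - Q n + 1 else 1)}"
    if "1 \<le> n" for n
    using eq[OF that] dig(1)[OF that] by (auto simp: min_def split: if_splits)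
  then show "x \<in> digit_set P F (\<lambda>n. if F n = Q n - 1 then P n - Q n + 1 else 1)"
    unfolding digit_set_def using dig(2) by (intro CollectI exI[of _ "cantor_digits P x"]) auto
next
  interpret P: cantor_base P by (rule cantor_base_basic[OF P])
  fix x assume "x \<in> digit_set P F (\<lambda>n. if F n = Q n - 1 then P n - Q n + 1 else 1)"
  then obtain E where x: "x = cantor_value P E"
    and E: "\<And>n. 1 \<le> n \<Longrightarrow> E n \<in> {F n..<F n + (if F n = Q n - 1 then P n - Q n + 1 else 1)}"
    unfolding digit_set_def by blast
  have Eb: "E n \<in> {0..P n - 1}" if "1 \<le> n" for n
    using E[OF that] F[OF that] less[OF that] by (auto split: if_splits)
  have E0: "\<exists>\<^sub>\<infinity>n. E n \<noteq> 0"
    unfolding INFM_nat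
  proof
    fix k
    obtain n where "k < n" "F n \<noteq> 0" using F0 unfolding INFM_nat by blast
    then show "\<exists>n>k. E n \<noteq> 0" using E[of n] F[of n] by (intro exI[of _ n]) auto
  qed
  \<comment> \<open>Where \<open>F n \<noteq> Q n - 1\<close> the digit is forced, and
    \<open>E n = F n\<close> lies below \<open>Q n - 1\<close>, hence below
    \<open>P n - 1\<close>.\<close>
  have E1: "\<exists>\<^sub>\<infinity>n. E n \<noteq> P n - 1"
    unfolding INFM_nat
  proof
    fix k
    obtain n where "k < n" "F n \<noteq> Q n - 1" using F1 unfolding INFM_nat by blast
    then show "\<exists>n>k. E n \<noteq> P n - 1"
      using E[of n] F[of n] less[of n] by (intro exI[of _ n]) (auto split: if_splits)
  qed
  have "psi P Q x = cantor_value Q F"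
    unfolding psi_eq_cantor_value
  proof (rule cantor_value_cong)
    fix n :: nat assume n: "1 \<le> n"
    have "cantor_digits P x n = E n"
      unfolding x using cantor_digits_value[of P E n] P Eb E0 E1 n by blast
    then show "min (cantor_digits P x n) (Q n - 1) = F n"
      using E[OF n] F[OF n] by (auto split: if_splits)
  qed
  then show "x \<in> level_set P Q (cantor_value Q F)"
    using P.value_bounds[of E] Eb E0 E1 by (auto simp: level_set_def x)
qed

section \<open>The dimension spectrum\<close>

text \<open>This trades the logarithm of a digit count for that of \<open>Q n\<close> or
  \<open>P n - Q n\<close>, at a cost of ln 2.\<close>

lemma ratio_tendsto_bounded_diff:
  fixes a b c :: "nat \<Rightarrow> real"
  assumes a: "filterlim a at_top sequentially" and c: "(\<lambda>n. c n / a n) \<longlonglongrightarrow> L"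
    and diff: "\<forall>\<^sub>F n in sequentially. \<bar>b n - c n\<bar> \<le> K"
  shows "(\<lambda>n. b n / a n) \<longlonglongrightarrow> L"
proof -
  have "(\<lambda>n. (b n - c n) / a n) \<longlonglongrightarrow> 0"
  proof (rule Lim_null_comparison)
    show "(\<lambda>n. K * (1 / a n)) \<longlonglongrightarrow> 0"
      using tendsto_mult[OF tendsto_const[of K] tendsto_inverse_0_at_top[OF a]]
      by (simp add: inverse_eq_divide)
    have "\<forall>\<^sub>F n in sequentially. 0 < a n"
      using a unfolding filterlim_at_top_dense by blast
    then show "\<forall>\<^sub>F n in sequentially. norm ((b n - c n) / a n) \<le> K * (1 / a n)"
      using diff by eventually_elim (simp add: abs_divide divide_right_mono)
  qed
  then have "(\<lambda>n. (b n - c n) / a n + c n / a n) \<longlonglongrightarrow> 0 + L"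
    by (intro tendsto_add c)
  then show ?thesis by (simp flip: add_divide_distrib)
qed

section \<open>A set of places with density \<delta> and bounded discrepancy\<close>

definition floor_jump :: "real \<Rightarrow> nat \<Rightarrow> bool" where
  "floor_jump \<delta> n \<longleftrightarrow> \<lfloor>\<delta> * (real n - 1)\<rfloor> < \<lfloor>\<delta> * real n\<rfloor>"

text \<open>As \<delta> \<le> 1, the floor rises by at most one per step, so counting its jumps
  telescopes.\<close>

lemma sum_floor_jump:
  assumes "0 \<le> \<delta>" "\<delta> \<le> 1"
  shows "(\<Sum>n=1..N. of_bool (floor_jump \<delta> n)) = real_of_int \<lfloor>\<delta> * real N\<rfloor>"
proof (induction N)
  case (Suc N)
  have "\<lfloor>\<delta> * real N\<rfloor> \<le> \<lfloor>\<delta> * real N + \<delta>\<rfloor>" "\<lfloor>\<delta> * real N + \<delta>\<rfloor> \<le> \<lfloor>\<delta> * real N\<rfloor> + 1"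
    using assms by linarith+
  then have "real_of_int \<lfloor>\<delta> * real N\<rfloor> + of_bool (floor_jump \<delta> (Suc N)) = real_of_int \<lfloor>\<delta> * real (Suc N)\<rfloor>"
    by (auto simp: floor_jump_def algebra_simps)
  with Suc show ?case by simp
qed simp

lemma floor_jump_density:
  assumes "0 \<le> \<delta>" "\<delta> \<le> 1"
  shows "\<bar>(\<Sum>n=1..N. of_bool (floor_jump \<delta> n)) - \<delta> * real N\<bar> \<le> 1"
  unfolding sum_floor_jump[OF assms] by linarith

text \<open>If all places beyond k were jumps, then N - k \<le> \<delta> N for all N, which fails
  once N > k / (1 - \<delta>). This keeps the digits of \<open>w\<close> from being eventually
  \<open>Q n - 1\<close>.\<close>

lemma infinitely_many_non_jumps:
  assumes "0 \<le> \<delta>" "\<delta> < 1"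
  shows "\<exists>\<^sub>\<infinity>n. \<not> floor_jump \<delta> n"
proof (rule ccontr)
  assume "\<not> ?thesis"
  then obtain k where k: "\<And>n. k < n \<Longrightarrow> floor_jump \<delta> n"
    unfolding INFM_nat by blast
  obtain N where N: "real k / (1 - \<delta>) < real N" using reals_Archimedean2 by blast
  have "real N - real k \<le> (\<Sum>n\<in>{k<..N}. of_bool (floor_jump \<delta> n))"
    using k by simp
  also have "\<dots> \<le> (\<Sum>n=1..N. of_bool (floor_jump \<delta> n))"
    by (intro sum_mono2) auto
  also have "\<dots> \<le> \<delta> * real N"
    using assms by (subst sum_floor_jump) auto
  finally have "real N * (1 - \<delta>) \<le> real k" by (simp add: algebra_simps)
  then show False using N assms by (simp add: pos_divide_less_eq)
qed

section \<open>Prescribed digits and the two dimension computations\<close>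

lemma dim_spectrum_set_ge:
  fixes P Q :: "nat \<Rightarrow> int"
  assumes P: "basic_sequence P" "grows_nicely (\<lambda>n. real_of_int (P n))"
    and Q: "basic_sequence Q" "grows_nicely (\<lambda>n. real_of_int (Q n))"
    and less: "\<And>n. 1 \<le> n \<Longrightarrow> Q n < P n"
    and \<gamma>: "(\<lambda>n. ln (real_of_int (P n - Q n)) / ln (real_of_int (P n))) \<longlonglongrightarrow> \<gamma>" "0 < \<gamma>"
    and \<alpha>: "0 \<le> \<alpha>" "\<alpha> < \<gamma>"
  shows "ereal (1 - \<alpha> / \<gamma>) \<le> hausdorff_dim (dim_spectrum_set P Q \<alpha>)"
proof -
  define \<delta> where "\<delta> = \<alpha> / \<gamma>"
  have \<delta>: "0 \<le> \<delta>" "\<delta> < 1" "\<delta> * \<gamma> = \<alpha>" using \<alpha> \<gamma>(2) by (simp_all add: \<delta>_def)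
  let ?J = "floor_jump \<delta>"
  have P2: "2 \<le> P n" and Q2: "2 \<le> Q n" if "1 \<le> n" for n
    using P(1) Q(1) that by (auto simp: basic_sequence_def)
  have P_top: "filterlim (\<lambda>n. real_of_int (P n)) at_top sequentially"
    and Q_top: "filterlim (\<lambda>n. real_of_int (Q n)) at_top sequentially"
    using P(2) Q(2) by (auto simp: grows_nicely_def)
  \<comment> \<open>Off the jumps, excluding \<open>Q n - 1\<close> makes that digit occur exactly
    at jumps, and excluding 0 prevents an expansion ending in zeros. For \<open>Q n = 2\<close>
    nothing would remain, and \<open>min\<close> and \<open>max\<close> leave the single digit
    0.\<close>
  define a where "a n = (if ?J n then Q n - 1 else min 1 (Q n - 2))" for n
  define m where "m n = (if ?J n then 1 else max 1 (Q n - 2))" for n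
  have "hausdorff_dim (digit_set Q a m) = ereal (1 - \<delta>)"
  proof (rule digit_set_dim[OF cantor_base_basic[OF Q(1)]])
    have "(\<lambda>n. ln (real_of_int (max 1 (Q n - 2))) / ln (real_of_int (Q n))) \<longlonglongrightarrow> 1"
    proof (rule ratio_tendsto_bounded_diff)
      show "filterlim (\<lambda>n. ln (real_of_int (Q n))) at_top sequentially"
        by (rule filterlim_compose[OF ln_at_top Q_top])
      show "(\<lambda>n. ln (real_of_int (Q n)) / ln (real_of_int (Q n))) \<longlonglongrightarrow> 1"
        using Q2 by (intro tendsto_eventually eventually_sequentiallyI[of 1]) force
      \<comment> \<open>From 4 on, \<open>Q n\<close> is at most twice \<open>Q n - 2\<close>, so
        losing two digits costs at most ln 2.\<close>
      have "\<forall>\<^sub>F n in sequentially. 4 < real_of_int (Q n)"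
        using Q_top unfolding filterlim_at_top_dense by blast
      then show "\<forall>\<^sub>F n in sequentially. \<bar>ln (real_of_int (max 1 (Q n - 2))) - ln (real_of_int (Q n))\<bar> \<le> ln 2"
      proof eventually_elim
        case (elim n)
        then have "ln (real_of_int (Q n)) \<le> ln (2 * (real_of_int (Q n) - 2))"
          by simp
        also have "\<dots> = ln 2 + ln (real_of_int (Q n) - 2)"
          by (subst ln_mult) (use elim in auto)
        finally show ?case using elim by (auto simp: max_def)
      qed
    qed
    then have "(\<lambda>n. ln (cantor_denom m n) / ln (cantor_denom Q n)) \<longlonglongrightarrow> (1 - \<delta>) * 1"
    proof (rule selected_denom_ratio[OF Q, rotated -1])
      show "1 \<le> m n" for n by (simp add: m_def)
      show "ln (real_of_int (m n)) = (1 - of_bool (?J n)) * ln (real_of_int (max 1 (Q n - 2)))" for n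
        by (simp add: m_def)
      show "\<bar>(\<Sum>n=1..N. 1 - of_bool (?J n)) - (1 - \<delta>) * real N\<bar> \<le> 1" for N
        using floor_jump_density[of \<delta> N] \<delta> by (simp add: sum_subtractf algebra_simps abs_minus_commute)
    qed simp
    then show "(\<lambda>n. ln (cantor_denom m n) / ln (cantor_denom Q n)) \<longlonglongrightarrow> 1 - \<delta>" by simp
    show "(\<lambda>n. ln (real_of_int (Q n)) / ln (cantor_denom Q n)) \<longlonglongrightarrow> 0"
      by (rule grows_nicely_denom_small[OF Q])
    fix n :: nat assume "1 \<le> n"
    from Q2[OF this] show "0 \<le> a n" "1 \<le> m n" "a n + m n \<le> Q n" "m n \<le> Q n - 1"
      by (auto simp: a_def m_def)
  qed (use \<delta> in auto)
  moreover have "digit_set Q a m \<subseteq> dim_spectrum_set P Q \<alpha>"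
  proof
    fix w assume "w \<in> digit_set Q a m"
    then obtain F where w: "w = cantor_value Q F" and F: "\<And>n. 1 \<le> n \<Longrightarrow> F n \<in> {a n..<a n + m n}"
      by (auto simp: digit_set_def)
    have FJ: "F n = Q n - 1 \<longleftrightarrow> ?J n" and F_range: "F n \<in> {0..Q n - 1}"
      and F_nonzero: "3 \<le> Q n \<Longrightarrow> F n \<noteq> 0" if "1 \<le> n" for n
      using F[OF that] Q2[OF that] by (auto simp: a_def m_def split: if_splits)
    have F1: "\<exists>\<^sub>\<infinity>n. F n \<noteq> Q n - 1"
      using infinitely_many_non_jumps[OF \<delta>(1,2)] FJ unfolding INFM_nat
      by (metis One_nat_def Suc_leI gr_implies_not0 neq0_conv)
    \<comment> \<open>The digit 0 can occur only where \<open>Q n = 2\<close>, that is, at finitely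
      many places.\<close>
    have "\<forall>\<^sub>F n in sequentially. 3 < real_of_int (Q n)"
      using Q_top unfolding filterlim_at_top_dense by blast
    then have "\<forall>\<^sub>F n in sequentially. F n \<noteq> 0"
      using eventually_ge_at_top[of 1] by eventually_elim (use F_nonzero in auto)
    then have F0: "\<exists>\<^sub>\<infinity>n. F n \<noteq> 0"
      unfolding cofinite_eq_sequentially by (intro eventually_frequently) auto
    \<comment> \<open>By \<open>FJ\<close> this count exceeds 1 exactly at the jumps, so the
      dimension of the level set is the same for every choice of \<open>F\<close>.\<close>
    define l where "l n = (if F n = Q n - 1 then P n - Q n + 1 else 1)" for n
    have level: "level_set P Q w = digit_set P F l"
      unfolding w l_def by (rule level_set_eq_digit_set[OF P(1) Q(1) less F_range F0 F1])
    have "hausdorff_dim (digit_set P F l) = ereal \<alpha>"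
    proof (rule digit_set_dim[OF cantor_base_basic[OF P(1)]])
      have "(\<lambda>n. ln (real_of_int (P n - Q n + 1)) / ln (real_of_int (P n))) \<longlonglongrightarrow> \<gamma>"
      proof (rule ratio_tendsto_bounded_diff[OF _ \<gamma>(1)])
        show "filterlim (\<lambda>n. ln (real_of_int (P n))) at_top sequentially"
          by (rule filterlim_compose[OF ln_at_top P_top])
        show "\<forall>\<^sub>F n in sequentially. \<bar>ln (real_of_int (P n - Q n + 1)) - ln (real_of_int (P n - Q n))\<bar> \<le> ln 2"
          using eventually_ge_at_top[of 1]
        proof eventually_elim
          case (elim n)
          define r where "r = real_of_int (P n - Q n)"
          have r: "1 \<le> r" using less[OF elim] by (simp add: r_def)
          then have "ln (r + 1) \<le> ln (2 * r)" by simp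
          also have "\<dots> = ln 2 + ln r" using r by (simp add: ln_mult)
          finally have "\<bar>ln (r + 1) - ln r\<bar> \<le> ln 2" using r by simp
          then show ?case by (simp add: r_def)
        qed
      qed
      then have "(\<lambda>n. ln (cantor_denom l n) / ln (cantor_denom P n)) \<longlonglongrightarrow> \<delta> * \<gamma>"
      proof (rule selected_denom_ratio[OF P, rotated -1])
        show "1 \<le> l n" if "1 \<le> n" for n using less[OF that] by (simp add: l_def)
        show "ln (real_of_int (l n)) = of_bool (?J n) * ln (real_of_int (P n - Q n + 1))" if "1 \<le> n" for n
          using FJ[OF that] by (simp add: l_def)
        show "\<bar>(\<Sum>n=1..N. of_bool (?J n)) - \<delta> * real N\<bar> \<le> 1" for N
          using floor_jump_density[of \<delta> N] \<delta> by simp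
      qed simp
      then show "(\<lambda>n. ln (cantor_denom l n) / ln (cantor_denom P n)) \<longlonglongrightarrow> \<alpha>" by (simp add: \<delta>(3))
      show "(\<lambda>n. ln (real_of_int (P n)) / ln (cantor_denom P n)) \<longlonglongrightarrow> 0"
        by (rule grows_nicely_denom_small[OF P])
      fix n :: nat assume "1 \<le> n"
      from F_range[OF this] P2[OF this] Q2[OF this] less[OF this]
      show "0 \<le> F n" "1 \<le> l n" "F n + l n \<le> P n" "l n \<le> P n - 1"
        by (auto simp: l_def)
    qed (use \<alpha> in auto)
    \<comment> \<open>The sequence \<open>F\<close> itself gives a point of the level set. The
      dimension alone does not ensure this when \<alpha> = 0, since the empty set also has dimension
      0.\<close>
    moreover have "F n \<in> {F n..<F n + l n}" if "1 \<le> n" for n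
      using less[OF that] by (simp add: l_def)
    then have "digit_set P F l \<noteq> {}"
      unfolding digit_set_def by blast
    then have "w \<in> psi P Q ` {0<..<1}"
      unfolding level[symmetric] by (auto simp: level_set_def)
    ultimately show "w \<in> dim_spectrum_set P Q \<alpha>"
      by (simp add: dim_spectrum_set_def level)
  qed
  ultimately show ?thesis
    using hausdorff_dim_mono by (metis \<delta>_def)
qed

theorem theorem1p4:
  fixes P Q :: "nat \<Rightarrow> int" and \<gamma> :: real
  assumes "basic_sequence P" and "basic_sequence Q"
    and "grows_nicely (\<lambda>n. real_of_int (P n))"
    and "grows_nicely (\<lambda>n. real_of_int (Q n))"
    and "grows_nicely (\<lambda>n. real_of_int (P n - Q n))"
    and "\<forall>n\<ge>1. P n > Q n"
    and "(\<lambda>n. ln (real_of_int (P n - Q n)) / ln (real_of_int (P n))) \<longlonglongrightarrow> \<gamma>"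
    and "\<gamma> \<in> {0<..1}"
  shows "(\<forall>\<alpha>\<in>{0..1}. hausdorff_dim (dim_spectrum_set P Q \<alpha>) \<ge> ereal (1 - \<alpha> / \<gamma>)) \<and>
         (\<forall>\<alpha>. 0 \<le> \<alpha> \<and> \<alpha> < \<gamma> \<longrightarrow> hausdorff_dim (dim_spectrum_set P Q \<alpha>) > 0)"
proof (intro conjI ballI allI impI)
  have \<gamma>: "0 < \<gamma>" using assms(8) by simp
  have main: "ereal (1 - \<alpha> / \<gamma>) \<le> hausdorff_dim (dim_spectrum_set P Q \<alpha>)" if "0 \<le> \<alpha>" "\<alpha> < \<gamma>" for \<alpha>
    using assms(6) by (intro dim_spectrum_set_ge[OF assms(1,3,2,4) _ assms(7) \<gamma> that]) auto
  fix \<alpha> :: real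
  show "ereal (1 - \<alpha> / \<gamma>) \<le> hausdorff_dim (dim_spectrum_set P Q \<alpha>)" if "\<alpha> \<in> {0..1}"
  proof (cases "\<alpha> < \<gamma>")
    case True
    then show ?thesis using main that by simp
  next
    case False
    \<comment> \<open>For \<alpha> \<ge> \<gamma> the bound is trivial, as dimension is
      nonnegative.\<close>
    then have "ereal (1 - \<alpha> / \<gamma>) \<le> 0" using \<gamma> by simp
    then show ?thesis using hausdorff_dim_nonneg by (rule order_trans)
  qed
  show "0 < hausdorff_dim (dim_spectrum_set P Q \<alpha>)" if "0 \<le> \<alpha> \<and> \<alpha> < \<gamma>"
  proof (rule less_le_trans)
    show "0 < ereal (1 - \<alpha> / \<gamma>)" using that \<gamma> by simp
    show "ereal (1 - \<alpha> / \<gamma>) \<le> hausdorff_dim (dim_spectrum_set P Q \<alpha>)"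
      using main that by blast
  qed
qed

end
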